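(* Let $n\ge 1$ be an integer, let $k=2^{[n/2]}$, and fix an irreducible complex representation $\rho\colon C_n^c\to \mathrm{End}(\mathbb C^k)$ of the complex Clifford algebra $C_n^c$. Then: (1) For $G=(\mathrm{Spin}(n)\times\mathbb C^\times)/K$, $p=\mathrm{Ad}\colon G\to SO(n)$ and $\epsilon=\rho|_G\colon G\to \mathrm{End}(\mathbb C^k)$, we have $$\rho(p(A)y)=\epsilon(A)\circ\rho(y)\circ\epsilon(A)^{-1}$$ for all $y\in C_n^c$ and $A\in G$. (2) If $G'$ is a Lie group, $p'\colon G'\to SO(n)$ is a group homomorphism, and $\epsilon'\colon G'\to \mathrm{End}(\mathbb C^k)$ is a representation such that $$\rho(p'(A)y)=\epsilon'(A)\circ\rho(y)\circ\epsilon'(A)^{-1}$$ for all $y\in C_n^c$ and $A\in G'$, then there is a unique homomorphism $f\colon G'\to G$ such that $$p'=p\circ f\qquad\text{and}\qquad \epsilon'=\epsilon\circ f.$$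
   Context: Clifford algebras: $C_n=Cl(\mathbb R^n,-\langle\cdot,\cdot\rangle)$ is the quotient of the tensor algebra $T(\mathbb R^n)$ by the ideal generated by $\{v\otimes v+\langle v,v\rangle\cdot 1 : v\in\mathbb R^n\}$, where $\langle\cdot,\cdot\rangle$ is the standard inner product; $C_n^c=C_n\otimes_{\mathbb R}\mathbb C$. Every irreducible complex representation of $C_n$ (equivalently, of $C_n^c$) has dimension $2^{[n/2]}$, where $[n/2]$ is the floor of $n/2$. The group $\mathrm{Spin}(n)$ is the double cover of $SO(n)$, realized inside $C_n$ as the set of products $v_1v_2\cdots v_l$ with $l\ge 0$ even and each $v_j\in\mathbb R^n$ of Euclidean norm $1$. $K=\{(1,1),(-1,-1)\}\subset \mathrm{Spin}(n)\times\mathbb C^\times$ is the two-element subgroup generated by $(-1,-1)$. The group $G=(\mathrm{Spin}(n)\times\mathbb C^\times)/K$ is identified, via $[A,c]\mapsto c\cdot A$, with the group of all elements of $C_n^c$ of the form $c\cdot v_1v_2\cdots v_l$ with $c\in\mathbb C^\times$, $l\ge 0$ even, and each $v_j\in\mathbb R^n$ of Euclidean norm $1$; the restriction $\rho|_G$ is taken with respect to this inclusion $G\subset C_n^c$. For $x\in G$ and $y\in\mathbb R^n\subset C_n^c$ one has $\mathrm{Ad}_x(y)=x\cdot y\cdot x^{-1}\in\mathbb R^n$, and $y\mapsto \mathrm{Ad}_x(y)$ is an element of $SO(n)$; the homomorphism $\mathrm{Ad}\colon G\to SO(n)$ is $x\mapsto \mathrm{Ad}_x$. Any $B\in SO(n)$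 acts on $C_n^c$ by the complex algebra automorphism induced by the standard action of $SO(n)$ on $\mathbb R^n$; this action is written $y\mapsto By$ for $y\in C_n^c$. A representation of a group $H$ written $H\to\mathrm{End}(\mathbb C^k)$ means a homomorphism into the group of invertible elements of $\mathrm{End}(\mathbb C^k)$. *)

theory Defs
  imports
    "HOL-Analysis.Analysis"
    "HOL-Library.Poly_Mapping"
    "HOL-Algebra.Coset"
begin

section \<open>The tensor algebra of \<open>\<real>\<^sup>n\<close>\<close>

text \<open>
  Words under concatenation form the free monoid, and finitely supported functions on a monoid
  carry the convolution product. Hence \<open>'n list \<Rightarrow>\<^sub>0 real\<close> is the free associative algebra on the
  standard basis of \<open>real ^ 'n\<close>, which is the tensor algebra: the word \<open>[i\<^sub>1, \<dots>, i\<^sub>r]\<close> is the tensor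
  \<open>e\<^sub>i\<^sub>1 \<otimes> \<dots> \<otimes> e\<^sub>i\<^sub>r\<close>.
\<close>

instantiation list :: (type) monoid_add
begin
definition zero_list :: "'a list" where "zero_list = []"
definition plus_list :: "'a list \<Rightarrow> 'a list \<Rightarrow> 'a list" where "plus_list = (@)"
instance by standard (simp_all add: zero_list_def plus_list_def)
end

lemma poly_mapping_add_induct [case_names single add]:
  fixes p :: "'a \<Rightarrow>\<^sub>0 'b::comm_monoid_add"
  assumes single: "\<And>k r. P (Poly_Mapping.single k r)"
    and add: "\<And>p q. P p \<Longrightarrow> P q \<Longrightarrow> P (p + q)"
  shows "P p"
proof -
  have "P (\<Sum>k\<in>K. Poly_Mapping.single k (Poly_Mapping.lookup p k))" if "finite K" for K
    using that
  proof (induction K rule: finite_induct)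
    case empty
    show ?case using single[of undefined 0] by simp
  next
    case (insert k K)
    then show ?case using single add by simp
  qed
  moreover have "p = (\<Sum>k\<in>Poly_Mapping.keys p. Poly_Mapping.single k (Poly_Mapping.lookup p k))"
    proof (rule poly_mapping_eqI)
    fix k
    have "Poly_Mapping.lookup (\<Sum>j\<in>Poly_Mapping.keys p. Poly_Mapping.single j (Poly_Mapping.lookup p j)) k
        = (\<Sum>j\<in>Poly_Mapping.keys p. if k = j then Poly_Mapping.lookup p j else 0)"
      unfolding lookup_sum by (intro sum.cong) (auto simp: lookup_single when_def)
    then show "Poly_Mapping.lookup p k
        = Poly_Mapping.lookup (\<Sum>j\<in>Poly_Mapping.keys p. Poly_Mapping.single j (Poly_Mapping.lookup p j)) k"
      by (simp add: in_keys_iff)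
  qed
  ultimately show ?thesis by (metis finite_keys)
qed

instantiation poly_mapping :: (type, real_vector) real_vector
begin

lift_definition scaleR_poly_mapping :: "real \<Rightarrow> ('a \<Rightarrow>\<^sub>0 'b) \<Rightarrow> 'a \<Rightarrow>\<^sub>0 'b"
  is "\<lambda>r f k. r *\<^sub>R f k"
  by (erule rev_finite_subset) auto

instance
  by standard (transfer, simp add: fun_eq_iff algebra_simps)+

end

lemma scaleR_single: "r *\<^sub>R Poly_Mapping.single k x = Poly_Mapping.single k (r *\<^sub>R x)"
  by transfer (auto simp: when_def)

instance poly_mapping :: (monoid_add, real_algebra) real_algebra
proof
  fix a :: real and p q :: "'a \<Rightarrow>\<^sub>0 'b"
  show "a *\<^sub>R p * q = a *\<^sub>R (p * q)"
  proof (induction p rule: poly_mapping_add_induct)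
    case (single k r)
    show ?case
      by (induction q rule: poly_mapping_add_induct)
        (simp_all add: scaleR_single mult_single distrib_left scaleR_add_right)
  qed (simp add: distrib_right scaleR_add_right)
  show "p * a *\<^sub>R q = a *\<^sub>R (p * q)"
  proof (induction p rule: poly_mapping_add_induct)
    case (single k r)
    show ?case
      by (induction q rule: poly_mapping_add_induct)
        (simp_all add: scaleR_single mult_single distrib_left scaleR_add_right)
  qed (simp add: distrib_right scaleR_add_right)
qed

instance poly_mapping :: (monoid_add, real_algebra_1) real_algebra_1 ..

type_synonym 'n tensor_algebra = "'n list \<Rightarrow>\<^sub>0 real"

definition tensor_vec :: "real ^ 'n \<Rightarrow> 'n::finite tensor_algebra" where
  "tensor_vec v = (\<Sum>i\<in>UNIV. (v $ i) *\<^sub>R Poly_Mapping.single [i] 1)"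

definition lin_ext :: "('a \<Rightarrow> 'v::real_vector) \<Rightarrow> ('a \<Rightarrow>\<^sub>0 real) \<Rightarrow> 'v" where
  "lin_ext \<phi> p = (\<Sum>w\<in>Poly_Mapping.keys p. Poly_Mapping.lookup p w *\<^sub>R \<phi> w)"

lemma lin_ext_single [simp]: "lin_ext \<phi> (Poly_Mapping.single w r) = r *\<^sub>R \<phi> w"
  by (cases "r = 0") (simp_all add: lin_ext_def)

lemma lin_ext_one [simp]: "lin_ext \<phi> 1 = \<phi> []"
proof -
  have "lin_ext \<phi> (Poly_Mapping.single 0 1) = \<phi> 0"
    by (simp only: lin_ext_single scaleR_one)
  then show ?thesis
    unfolding single_one by (simp add: zero_list_def)
qed

lemma lin_ext_0 [simp]: "lin_ext \<phi> 0 = 0"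
  by (simp add: lin_ext_def)

lemma lin_ext_add: "lin_ext \<phi> (p + q) = lin_ext \<phi> p + lin_ext \<phi> q"
  unfolding lin_ext_def by (rule setsum_keys_plus_distrib) (simp_all add: scaleR_add_left)

lemma lin_ext_scaleR: "lin_ext \<phi> (r *\<^sub>R p) = r *\<^sub>R lin_ext \<phi> p"
  by (induction p rule: poly_mapping_add_induct)
    (simp_all add: scaleR_single scaleR_add_right lin_ext_add)

lemma lin_ext_minus: "lin_ext \<phi> (- p) = - lin_ext \<phi> p"
  using lin_ext_scaleR[of \<phi> "-1" p] by simp

lemma lin_ext_diff: "lin_ext \<phi> (p - q) = lin_ext \<phi> p - lin_ext \<phi> q"
  using lin_ext_add[of \<phi> p "- q"] by (simp add: lin_ext_minus)

lemma lin_ext_sum: "lin_ext \<phi> (sum f I) = (\<Sum>i\<in>I. lin_ext \<phi> (f i))"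
  by (induction I rule: infinite_finite_induct) (simp_all add: lin_ext_add)

text \<open>The algebra homomorphism out of the tensor algebra with prescribed values on the basis.\<close>

definition tensor_lift :: "('n \<Rightarrow> 'a::real_algebra_1) \<Rightarrow> 'n tensor_algebra \<Rightarrow> 'a" where
  "tensor_lift h = lin_ext (\<lambda>w. prod_list (map h w))"

lemma tensor_lift_mult: "tensor_lift h (p * q) = tensor_lift h p * tensor_lift h q"
proof (induction p rule: poly_mapping_add_induct)
  case (single v r)
  show ?case
    by (induction q rule: poly_mapping_add_induct)
      (simp_all add: tensor_lift_def mult_single lin_ext_add distrib_left plus_list_def)
qed (simp add: distrib_right tensor_lift_def lin_ext_add)

lemma tensor_lift_0: "tensor_lift h 0 = 0"
  by (simp add: tensor_lift_def)

lemma tensor_lift_add: "tensor_lift h (p + q) = tensor_lift h p + tensor_lift h q"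
  by (simp add: tensor_lift_def lin_ext_add)

lemma tensor_lift_one: "tensor_lift h 1 = 1"
  by (simp add: tensor_lift_def)

lemma tensor_lift_vec: "tensor_lift h (tensor_vec v) = (\<Sum>i\<in>UNIV. (v $ i) *\<^sub>R h i)"
  by (simp add: tensor_lift_def tensor_vec_def lin_ext_sum lin_ext_scaleR)

lemma tensor_vec_add: "tensor_vec (v + w) = tensor_vec v + tensor_vec w"
  by (simp add: tensor_vec_def scaleR_add_left sum.distrib)

lemma tensor_vec_scaleR: "tensor_vec (r *\<^sub>R v) = r *\<^sub>R tensor_vec v"
  by (simp add: tensor_vec_def scaleR_sum_right)

section \<open>The Clifford algebra\<close>

definition two_sided_ideal :: "'a::ring_1 set \<Rightarrow> bool" where
  "two_sided_ideal I \<longleftrightarrow> 0 \<in> I \<and> (\<forall>x\<in>I. \<forall>y\<in>I. x + y \<in> I) \<and> (\<forall>x\<in>I. \<forall>a b. a * x * b \<in> I)"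

definition clifford_relators :: "'n::finite tensor_algebra set" where
  "clifford_relators = {tensor_vec v * tensor_vec v + (v \<bullet> v) *\<^sub>R 1 | v :: real ^ 'n. True}"

definition clifford_ideal :: "'n::finite tensor_algebra set" where
  "clifford_ideal = two_sided_ideal hull clifford_relators"

lemma two_sided_ideal_clifford_ideal: "two_sided_ideal clifford_ideal"
  unfolding clifford_ideal_def
  by (rule hull_in) (auto simp: two_sided_ideal_def)

lemma clifford_ideal_simps:
  shows clifford_ideal_0: "0 \<in> clifford_ideal"
    and clifford_ideal_add: "x \<in> clifford_ideal \<Longrightarrow> y \<in> clifford_ideal \<Longrightarrow> x + y \<in> clifford_ideal"
    and clifford_ideal_mult: "x \<in> clifford_ideal \<Longrightarrow> a * x * b \<in> clifford_ideal"
  using two_sided_ideal_clifford_ideal by (auto simp: two_sided_ideal_def)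

lemma clifford_ideal_minus: "x \<in> clifford_ideal \<Longrightarrow> - x \<in> clifford_ideal"
  using clifford_ideal_mult[of x "- 1" 1] by simp

lemma clifford_ideal_left: "x \<in> clifford_ideal \<Longrightarrow> a * x \<in> clifford_ideal"
  using clifford_ideal_mult[of x a 1] by simp

lemma clifford_ideal_right: "x \<in> clifford_ideal \<Longrightarrow> x * b \<in> clifford_ideal"
  using clifford_ideal_mult[of x 1 b] by simp

lemma clifford_ideal_scaleR: "x \<in> clifford_ideal \<Longrightarrow> r *\<^sub>R x \<in> clifford_ideal"
  using clifford_ideal_left[of x "r *\<^sub>R 1"] by simp

lemma clifford_relator_in_ideal:
  "tensor_vec v * tensor_vec v + (v \<bullet> v) *\<^sub>R 1 \<in> clifford_ideal"
  unfolding clifford_ideal_def by (rule hull_inc) (auto simp: clifford_relators_def)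

lemma clifford_ideal_minimal:
  assumes "two_sided_ideal J"
    and "\<And>v :: real ^ 'n. tensor_vec v * tensor_vec v + (v \<bullet> v) *\<^sub>R 1 \<in> J"
  shows "(clifford_ideal :: 'n::finite tensor_algebra set) \<subseteq> J"
  unfolding clifford_ideal_def by (rule hull_minimal) (use assms in \<open>auto simp: clifford_relators_def\<close>)

text \<open>
  The ideal is proper: the operators \<open>ext_op i\<close> on functions of subsets of the index type satisfy
  the Clifford relations.
\<close>

definition ext_sign :: "'n::finite \<Rightarrow> 'n set \<Rightarrow> real" where
  "ext_sign i S = (-1) ^ card {j \<in> S. to_nat j < to_nat i} * (if i \<in> S then 1 else -1)"

definition set_flip :: "'n \<Rightarrow> 'n set \<Rightarrow> 'n set" where
  "set_flip i S = (if i \<in> S then S - {i} else insert i S)"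

definition ext_op :: "'n::finite \<Rightarrow> ('n set \<Rightarrow> real) \<Rightarrow> 'n set \<Rightarrow> real" where
  "ext_op i m S = ext_sign i S * m (set_flip i S)"

lemma ext_op_square: "ext_op i (ext_op i m) S = - m S"
proof -
  have "set_flip i (set_flip i S) = S" by (auto simp: set_flip_def)
  moreover have "{j \<in> set_flip i S. to_nat j < to_nat i} = {j \<in> S. to_nat j < to_nat i}"
    by (auto simp: set_flip_def)
  moreover have "i \<in> set_flip i S \<longleftrightarrow> i \<notin> S" by (auto simp: set_flip_def)
  ultimately show ?thesis
    by (simp add: ext_op_def ext_sign_def flip: power_add mult_2)
qed

lemma ext_op_anticommute_less:
  assumes "to_nat i < to_nat j"
  shows "ext_op i (ext_op j m) S = - ext_op j (ext_op i m) S"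
proof -
  have ij: "i \<noteq> j" using assms by auto
  have 1: "set_flip i (set_flip j S) = set_flip j (set_flip i S)"
    using ij by (auto simp: set_flip_def)
  have 2: "{l \<in> set_flip j S. to_nat l < to_nat i} = {l \<in> S. to_nat l < to_nat i}"
    using assms by (auto simp: set_flip_def)
  have 3: "i \<in> set_flip j S \<longleftrightarrow> i \<in> S" "j \<in> set_flip i S \<longleftrightarrow> j \<in> S"
    using ij by (auto simp: set_flip_def)
  let ?T = "{l \<in> S. to_nat l < to_nat j}"
  have 4: "(-1::real) ^ card {l \<in> set_flip i S. to_nat l < to_nat j} = - ((-1) ^ card ?T)"
  proof (cases "i \<in> S")
    case True
    have "{l \<in> set_flip i S. to_nat l < to_nat j} = ?T - {i}"
      using True by (auto simp: set_flip_def)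
    moreover have "card ?T = Suc (card (?T - {i}))"
      using True assms by (intro card.remove) auto
    ultimately show ?thesis by simp
  next
    case False
    have "{l \<in> set_flip i S. to_nat l < to_nat j} = insert i ?T"
      using False assms by (auto simp: set_flip_def)
    then show ?thesis using False by simp
  qed
  show ?thesis
    by (simp add: ext_op_def ext_sign_def 1 2 3 4)
qed

lemma ext_op_anticommute:
  assumes "i \<noteq> j"
  shows "ext_op i (ext_op j m) S + ext_op j (ext_op i m) S = 0"
proof -
  have "to_nat i < to_nat j \<or> to_nat j < to_nat i"
    using assms by (metis inj_to_nat injD linorder_neqE_nat)
  then show ?thesis
    using ext_op_anticommute_less[of i j m S] ext_op_anticommute_less[of j i m S] by auto
qed

lemma ext_op_sum:
  "ext_op i (\<lambda>S. \<Sum>j\<in>J. c j * f j S) S = (\<Sum>j\<in>J. c j * ext_op i (f j) S)"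
  by (simp add: ext_op_def sum_distrib_left mult_ac)

definition ext_act :: "'n::finite tensor_algebra \<Rightarrow> ('n set \<Rightarrow> real) \<Rightarrow> 'n set \<Rightarrow> real" where
  "ext_act p m S = lin_ext (\<lambda>w. foldr ext_op w m S) p"

lemma ext_act_add: "ext_act (p + q) m S = ext_act p m S + ext_act q m S"
  by (simp add: ext_act_def lin_ext_add)

lemma foldr_ext_op_add:
  "foldr ext_op w (\<lambda>S. f S + g S) = (\<lambda>S. foldr ext_op w f S + foldr ext_op w g S)"
  by (induction w) (simp_all add: ext_op_def fun_eq_iff algebra_simps)

lemma foldr_ext_op_mult:
  "foldr ext_op w (\<lambda>S. r * f S) = (\<lambda>S. r * foldr ext_op w f S)"
  by (induction w) (simp_all add: ext_op_def fun_eq_iff algebra_simps)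

lemma ext_act_mult: "ext_act (p * q) m S = ext_act p (ext_act q m) S"
proof (induction p rule: poly_mapping_add_induct)
  case (single v r)
  show ?case
  proof (induction q rule: poly_mapping_add_induct)
    case (single w s)
    have "ext_act (Poly_Mapping.single w s) m = (\<lambda>S. s * foldr ext_op w m S)"
      by (simp add: ext_act_def fun_eq_iff)
    then show ?case
      by (simp add: ext_act_def mult_single plus_list_def foldr_ext_op_mult)
  next
    case (add p q)
    have "ext_act (p + q) m = (\<lambda>S. ext_act p m S + ext_act q m S)"
      by (simp add: ext_act_add fun_eq_iff)
    with add show ?case
      by (simp add: distrib_left ext_act_add) (simp add: ext_act_def foldr_ext_op_add algebra_simps)
  qed
qed (simp add: distrib_right ext_act_add)

lemma ext_act_vec: "ext_act (tensor_vec v) m S = (\<Sum>i\<in>UNIV. (v $ i) * ext_op i m S)"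
  by (simp add: ext_act_def tensor_vec_def lin_ext_sum lin_ext_scaleR)

lemma ext_act_relator: "ext_act (tensor_vec v * tensor_vec v + (v \<bullet> v) *\<^sub>R 1) m S = 0"
proof -
  let ?E = "\<lambda>i j. ext_op i (ext_op j m) S"
  let ?X = "\<Sum>i\<in>UNIV. \<Sum>j\<in>UNIV. v $ i * v $ j * ?E i j"
  have "ext_act (tensor_vec v) m = (\<lambda>S. \<Sum>i\<in>UNIV. (v $ i) * ext_op i m S)"
    by (simp add: ext_act_vec fun_eq_iff)
  then have X: "ext_act (tensor_vec v * tensor_vec v) m S = ?X"
    by (simp add: ext_act_mult ext_act_vec ext_op_sum sum_distrib_left mult_ac)
  have "?X = (\<Sum>i\<in>UNIV. \<Sum>j\<in>UNIV. v $ i * v $ j * ?E j i)"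
    by (subst sum.swap) (simp add: mult_ac)
  then have "2 * ?X = (\<Sum>i\<in>UNIV. \<Sum>j\<in>UNIV. v $ i * v $ j * (?E i j + ?E j i))"
    by (simp add: distrib_left sum.distrib)
  also have "\<dots> = (\<Sum>i\<in>UNIV. \<Sum>j\<in>UNIV. if j = i then - 2 * (v $ i * v $ i * m S) else 0)"
    by (intro sum.cong refl) (auto simp: ext_op_square ext_op_anticommute)
  also have "\<dots> = - 2 * ((v \<bullet> v) * m S)"
    by (simp add: inner_vec_def sum_distrib_right sum_distrib_left sum_negf)
  finally have "?X = - ((v \<bullet> v) * m S)" by simp
  moreover have "ext_act ((v \<bullet> v) *\<^sub>R 1) m S = (v \<bullet> v) * m S"
    by (simp add: ext_act_def lin_ext_scaleR)
  ultimately show ?thesis by (simp add: ext_act_add X)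
qed

lemma one_notin_clifford_ideal: "1 \<notin> (clifford_ideal :: 'n::finite tensor_algebra set)"
proof
  assume one: "1 \<in> (clifford_ideal :: 'n tensor_algebra set)"
  let ?J = "{p :: 'n tensor_algebra. \<forall>m S. ext_act p m S = 0}"
  have zero: "foldr ext_op w (\<lambda>S. 0) = (\<lambda>S. 0)" for w :: "'n list"
    by (induction w) (simp_all add: ext_op_def fun_eq_iff)
  have zero': "ext_act a (\<lambda>S. 0) = (\<lambda>S. 0)" for a :: "'n tensor_algebra"
    by (simp add: ext_act_def zero lin_ext_def fun_eq_iff)
  have "ext_act (a * p * b) m S = 0" if "\<forall>m S. ext_act p m S = 0" for a p b m and S :: "'n set"
  proof -
    have "ext_act p n = (\<lambda>S. 0)" for n using that by (simp add: fun_eq_iff)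
    then show ?thesis by (simp add: ext_act_mult zero')
  qed
  then have "two_sided_ideal ?J"
    by (auto simp: two_sided_ideal_def ext_act_add) (simp add: ext_act_def)
  then have "clifford_ideal \<subseteq> ?J"
    by (rule clifford_ideal_minimal) (simp add: ext_act_relator)
  with one have "ext_act 1 (\<lambda>S. 1) ({} :: 'n set) = 0" by auto
  then show False
    by (simp add: ext_act_def)
qed

definition clifford_eq :: "'n::finite tensor_algebra \<Rightarrow> 'n tensor_algebra \<Rightarrow> bool" where
  "clifford_eq p q \<longleftrightarrow> p - q \<in> clifford_ideal"

lemma equivp_clifford_eq: "equivp clifford_eq"
proof (rule equivpI)
  show "reflp clifford_eq"
    by (simp add: reflp_def clifford_eq_def clifford_ideal_0)
  show "symp clifford_eq"
    unfolding symp_def clifford_eq_def using clifford_ideal_minus by fastforce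
  show "transp clifford_eq"
    unfolding transp_def clifford_eq_def using clifford_ideal_add by fastforce
qed

quotient_type 'n clifford = "'n::finite tensor_algebra" / clifford_eq
  by (rule equivp_clifford_eq)

instantiation clifford :: (finite) real_algebra_1
begin

lift_definition zero_clifford :: "'a clifford" is 0 .
lift_definition one_clifford :: "'a clifford" is 1 .
lift_definition uminus_clifford :: "'a clifford \<Rightarrow> 'a clifford" is uminus
  unfolding clifford_eq_def by (drule clifford_ideal_minus) simp
lift_definition plus_clifford :: "'a clifford \<Rightarrow> 'a clifford \<Rightarrow> 'a clifford" is "(+)"
  unfolding clifford_eq_def by (drule (1) clifford_ideal_add) (simp add: algebra_simps)
lift_definition minus_clifford :: "'a clifford \<Rightarrow> 'a clifford \<Rightarrow> 'a clifford" is "(-)"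
  unfolding clifford_eq_def
  by (drule clifford_ideal_minus, drule (1) clifford_ideal_add) (simp add: algebra_simps)
lift_definition times_clifford :: "'a clifford \<Rightarrow> 'a clifford \<Rightarrow> 'a clifford" is "(*)"
proof -
  fix p p' q q' :: "'a tensor_algebra"
  assume "clifford_eq p p'" "clifford_eq q q'"
  then have "(p - p') * q + p' * (q - q') \<in> clifford_ideal"
    unfolding clifford_eq_def
    by (intro clifford_ideal_add clifford_ideal_left clifford_ideal_right)
  then show "clifford_eq (p * q) (p' * q')"
    by (simp add: clifford_eq_def algebra_simps)
qed
lift_definition scaleR_clifford :: "real \<Rightarrow> 'a clifford \<Rightarrow> 'a clifford" is "scaleR"
  unfolding clifford_eq_def by (drule clifford_ideal_scaleR) (simp add: scaleR_diff_right)

instance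
proof
  show "(0 :: 'a clifford) \<noteq> 1"
    by transfer (use one_notin_clifford_ideal clifford_ideal_minus[of "- 1"] in
        \<open>auto simp: clifford_eq_def\<close>)
qed (transfer, simp add: clifford_eq_def clifford_ideal_0 algebra_simps)+

end

lift_definition clifford_vec :: "real ^ 'n \<Rightarrow> 'n::finite clifford" is tensor_vec .

lemma clifford_vec_square: "clifford_vec v * clifford_vec v = - ((v \<bullet> v) *\<^sub>R 1)"
  by transfer (simp add: clifford_eq_def clifford_relator_in_ideal)

text \<open>
  The map induced by \<open>B\<close> on the tensor algebra sends \<open>e\<^sub>i\<close> to \<open>B e\<^sub>i\<close>, the \<open>i\<close>-th column of \<open>B\<close>. It
  descends to the Clifford algebra only for orthogonal \<open>B\<close>, so \<open>clifford_map\<close> is meaningful only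
  for such \<open>B\<close>; see \<open>clifford_map_abs\<close> below.
\<close>

definition tensor_map :: "real ^ 'n ^ 'n \<Rightarrow> 'n::finite tensor_algebra \<Rightarrow> 'n tensor_algebra" where
  "tensor_map B = tensor_lift (\<lambda>i. tensor_vec (column i B))"

definition clifford_map :: "real ^ 'n ^ 'n \<Rightarrow> 'n::finite clifford \<Rightarrow> 'n clifford" where
  "clifford_map B x = abs_clifford (tensor_map B (rep_clifford x))"

lemma tensor_map_vec: "tensor_map B (tensor_vec v) = tensor_vec (B *v v)"
proof -
  have sum: "(\<Sum>i\<in>I. (v $ i) *\<^sub>R tensor_vec (column i B)) = tensor_vec (\<Sum>i\<in>I. (v $ i) *\<^sub>R column i B)"
    if "finite I" for I
    using that by (induction I rule: finite_induct)
      (simp_all add: tensor_vec_add tensor_vec_scaleR, simp add: tensor_vec_def)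
  have "(\<Sum>i\<in>UNIV. (v $ i) *\<^sub>R column i B) = B *v v"
    by (simp add: matrix_mult_sum scalar_mult_eq_scaleR)
  then show ?thesis
    using sum[of UNIV] by (simp add: tensor_map_def tensor_lift_vec)
qed

lemma clifford_map_abs:
  fixes B :: "real ^ 'n::finite ^ 'n"
  assumes "orthogonal_matrix B"
  shows "clifford_map B (abs_clifford p) = abs_clifford (tensor_map B p)"
proof -
  let ?J = "{p. tensor_map B p \<in> clifford_ideal}"
  have inner: "(B *v v) \<bullet> (B *v v) = v \<bullet> v" for v
    using assms orthogonal_transformation_matrix[of "(*v) B"] by (simp add: orthogonal_transformation_def)
  have "two_sided_ideal ?J"
    by (auto simp: two_sided_ideal_def tensor_map_def tensor_lift_mult clifford_ideal_mult
        clifford_ideal_0 clifford_ideal_add tensor_lift_0 tensor_lift_add)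
  moreover have "tensor_vec v * tensor_vec v + (v \<bullet> v) *\<^sub>R 1 \<in> ?J" for v
  proof -
    have "tensor_map B (tensor_vec v * tensor_vec v + (v \<bullet> v) *\<^sub>R 1)
        = tensor_map B (tensor_vec v) * tensor_map B (tensor_vec v) + (v \<bullet> v) *\<^sub>R tensor_map B 1"
      by (simp add: tensor_map_def tensor_lift_mult flip: tensor_lift_mult)
        (simp add: tensor_lift_def lin_ext_add lin_ext_scaleR)
    also have "\<dots> = tensor_vec (B *v v) * tensor_vec (B *v v) + ((B *v v) \<bullet> (B *v v)) *\<^sub>R 1"
      by (simp add: tensor_map_vec inner) (simp add: tensor_map_def tensor_lift_one)
    finally show ?thesis using clifford_relator_in_ideal[of "B *v v"] by simp
  qed
  ultimately have sub: "clifford_ideal \<subseteq> ?J"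
    by (rule clifford_ideal_minimal)
  have "clifford_eq (rep_clifford (abs_clifford p)) p"
    by (metis Quotient3_abs_rep[OF Quotient3_clifford] clifford.abs_eq_iff)
  then have "tensor_map B (rep_clifford (abs_clifford p) - p) \<in> clifford_ideal"
    using sub by (auto simp: clifford_eq_def)
  then have "clifford_eq (tensor_map B (rep_clifford (abs_clifford p))) (tensor_map B p)"
    by (simp add: clifford_eq_def tensor_map_def tensor_lift_def lin_ext_diff)
  then show ?thesis
    by (simp add: clifford_map_def clifford.abs_eq_iff)
qed

lemma clifford_map_vec:
  assumes "orthogonal_matrix B"
  shows "clifford_map B (clifford_vec v) = clifford_vec (B *v v)"
  by (simp add: clifford_vec.abs_eq clifford_map_abs[OF assms] tensor_map_vec)

lemma clifford_map_hom:
  assumes B: "orthogonal_matrix B"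
  shows "clifford_map B 1 = 1"
    and "clifford_map B (x + y) = clifford_map B x + clifford_map B y"
    and "clifford_map B (x * y) = clifford_map B x * clifford_map B y"
    and "clifford_map B (r *\<^sub>R x) = r *\<^sub>R clifford_map B x"
proof -
  obtain p q where [simp]: "x = abs_clifford p" "y = abs_clifford q"
    by (metis Quotient3_abs_rep[OF Quotient3_clifford])
  show "clifford_map B 1 = 1"
    by (simp add: one_clifford.abs_eq clifford_map_abs[OF B] tensor_map_def tensor_lift_one)
  show "clifford_map B (x + y) = clifford_map B x + clifford_map B y"
    by (simp add: plus_clifford.abs_eq clifford_map_abs[OF B] tensor_map_def
        tensor_lift_def lin_ext_add)
  show "clifford_map B (x * y) = clifford_map B x * clifford_map B y"
    by (simp add: times_clifford.abs_eq clifford_map_abs[OF B] tensor_map_def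
        tensor_lift_mult)
  show "clifford_map B (r *\<^sub>R x) = r *\<^sub>R clifford_map B x"
    by (simp add: scaleR_clifford.abs_eq clifford_map_abs[OF B] tensor_map_def
        tensor_lift_def lin_ext_scaleR)
qed

section \<open>Complexification\<close>

text \<open>\<open>Cx a b\<close> stands for \<open>a \<otimes> 1 + b \<otimes> \<i>\<close> in \<open>A \<otimes>\<^sub>\<real> \<complex>\<close>.\<close>

datatype 'a complexified = Cx (cx_re: 'a) (cx_im: 'a)

instantiation complexified :: (real_algebra_1) real_algebra_1
begin

definition zero_complexified :: "'a complexified" where "0 = Cx 0 0"
definition one_complexified :: "'a complexified" where "1 = Cx 1 0"
definition uminus_complexified :: "'a complexified \<Rightarrow> 'a complexified" where
  "- x = Cx (- cx_re x) (- cx_im x)"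
definition plus_complexified :: "'a complexified \<Rightarrow> 'a complexified \<Rightarrow> 'a complexified" where
  "x + y = Cx (cx_re x + cx_re y) (cx_im x + cx_im y)"
definition minus_complexified :: "'a complexified \<Rightarrow> 'a complexified \<Rightarrow> 'a complexified" where
  "x - y = Cx (cx_re x - cx_re y) (cx_im x - cx_im y)"
definition times_complexified :: "'a complexified \<Rightarrow> 'a complexified \<Rightarrow> 'a complexified" where
  "x * y = Cx (cx_re x * cx_re y - cx_im x * cx_im y) (cx_re x * cx_im y + cx_im x * cx_re y)"
definition scaleR_complexified :: "real \<Rightarrow> 'a complexified \<Rightarrow> 'a complexified" where
  "r *\<^sub>R x = Cx (r *\<^sub>R cx_re x) (r *\<^sub>R cx_im x)"

instance
  by standard
    (auto simp: zero_complexified_def one_complexified_def uminus_complexified_def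
      plus_complexified_def minus_complexified_def times_complexified_def scaleR_complexified_def
      complexified.expand algebra_simps)

end

type_synonym 'n cclifford = "'n clifford complexified"

definition complexify :: "'a \<Rightarrow> 'a::real_algebra_1 complexified" where
  "complexify a = Cx a 0"

text \<open>Multiplication by the scalar \<open>c\<close> is multiplication by the central element \<open>cx_scalar c\<close>.\<close>

definition cx_scalar :: "complex \<Rightarrow> 'a::real_algebra_1 complexified" where
  "cx_scalar c = Cx (of_real (Re c)) (of_real (Im c))"

definition cclifford_vec :: "real ^ 'n \<Rightarrow> 'n::finite cclifford" where
  "cclifford_vec v = complexify (clifford_vec v)"

definition cclifford_map :: "real ^ 'n ^ 'n \<Rightarrow> 'n::finite cclifford \<Rightarrow> 'n cclifford" where
  "cclifford_map B = map_complexified (clifford_map B)"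

section \<open>Complex representations\<close>

definition complex_algebra_rep :: "('a::real_algebra_1 complexified \<Rightarrow> complex ^ 'k ^ 'k) \<Rightarrow> bool" where
  "complex_algebra_rep \<rho> \<longleftrightarrow>
     (\<forall>x y. \<rho> (x + y) = \<rho> x + \<rho> y) \<and>
     (\<forall>x y. \<rho> (x * y) = \<rho> x ** \<rho> y) \<and>
     (\<forall>c. \<rho> (cx_scalar c) = mat c)"

definition irreducible_rep :: "('a::real_algebra_1 complexified \<Rightarrow> complex ^ 'k ^ 'k) \<Rightarrow> bool" where
  "irreducible_rep \<rho> \<longleftrightarrow>
     complex_algebra_rep \<rho> \<and>
     (\<forall>W. vec.subspace W \<and> (\<forall>x. \<forall>w\<in>W. \<rho> x *v w \<in> W) \<longrightarrow> W = {0} \<or> W = UNIV)"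

section \<open>The groups\<close>

definition unit_group :: "'a::ring_1 monoid" where
  "unit_group = \<lparr>carrier = {x. \<exists>y. x * y = 1 \<and> y * x = 1}, monoid.mult = (*), one = 1\<rparr>"

definition SO_group :: "(real ^ 'n ^ 'n) monoid" where
  "SO_group = \<lparr>carrier = {B. rotation_matrix B}, monoid.mult = (**), one = mat 1\<rparr>"

definition GL_group :: "(complex ^ 'k ^ 'k) monoid" where
  "GL_group = \<lparr>carrier = {A. invertible A}, monoid.mult = (**), one = mat 1\<rparr>"

definition Spin_group :: "'n::finite clifford monoid" where
  "Spin_group =
     \<lparr>carrier = {prod_list (map clifford_vec vs) | vs. even (length vs) \<and> (\<forall>v\<in>set vs. norm v = 1)},
      monoid.mult = (*), one = 1\<rparr>"

definition spinc_kernel :: "('n::finite clifford \<times> complex) set" where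
  "spinc_kernel = {(1, 1), (- 1, - 1)}"

definition SpinC_group :: "('n::finite clifford \<times> complex) set monoid" where
  "SpinC_group = (Spin_group \<times>\<times> (unit_group :: complex monoid)) Mod spinc_kernel"

text \<open>
  The inclusion \<open>[A, c] \<mapsto> c \<cdot> A\<close> into the complex Clifford algebra; the product is constant on cosets
  of \<open>spinc_kernel\<close>, so the image below is a singleton.
\<close>

definition spinc_incl :: "('n::finite clifford \<times> complex) set \<Rightarrow> 'n cclifford" where
  "spinc_incl X = the_elem ((\<lambda>(A, c). cx_scalar c * complexify A) ` X)"

definition Ad :: "('n::finite clifford \<times> complex) set \<Rightarrow> real ^ 'n ^ 'n" where
  "Ad X = (THE B. \<forall>y. cclifford_vec (B *v y) =
     spinc_incl X * cclifford_vec y * inv\<^bsub>unit_group\<^esub> (spinc_incl X))"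

definition spinc_rep ::
  "('n::finite cclifford \<Rightarrow> complex ^ 'k ^ 'k) \<Rightarrow> ('n clifford \<times> complex) set \<Rightarrow> complex ^ 'k ^ 'k"
where
  "spinc_rep \<rho> X = \<rho> (spinc_incl X)"

section \<open>Lie groups\<close>

text \<open>
  Charts take values in the topological space \<open>Euclidean_space d\<close>, whose points are the functions
  \<open>nat \<Rightarrow> real\<close> vanishing from \<open>d\<close> on; in this way every dimension, including \<open>0\<close>, is covered.
\<close>

primrec Ck_on :: "nat \<Rightarrow> nat \<Rightarrow> (nat \<Rightarrow> real) set \<Rightarrow> ((nat \<Rightarrow> real) \<Rightarrow> real) \<Rightarrow> bool" where
  "Ck_on d 0 S f \<longleftrightarrow> continuous_map (subtopology (Euclidean_space d) S) euclideanreal f"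
| "Ck_on d (Suc k) S f \<longleftrightarrow>
     continuous_map (subtopology (Euclidean_space d) S) euclideanreal f \<and>
     (\<forall>i<d. \<exists>g. (\<forall>x\<in>S. ((\<lambda>t. f (x(i := t))) has_real_derivative g x) (at (x i))) \<and> Ck_on d k S g)"

definition smooth_coord :: "nat \<Rightarrow> (nat \<Rightarrow> real) set \<Rightarrow> ((nat \<Rightarrow> real) \<Rightarrow> real) \<Rightarrow> bool" where
  "smooth_coord d S f \<longleftrightarrow> (\<forall>k. Ck_on d k S f)"

record 'a manifold =
  man_dim :: nat
  man_top :: "'a topology"
  man_atlas :: "('a set \<times> ('a \<Rightarrow> nat \<Rightarrow> real)) set"

definition smooth_manifold :: "'a manifold \<Rightarrow> bool" where
  "smooth_manifold M \<longleftrightarrow>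
     Hausdorff_space (man_top M) \<and> second_countable (man_top M) \<and>
     (\<Union>(U, \<phi>)\<in>man_atlas M. U) = topspace (man_top M) \<and>
     (\<forall>(U, \<phi>)\<in>man_atlas M.
        openin (man_top M) U \<and> openin (Euclidean_space (man_dim M)) (\<phi> ` U) \<and>
        homeomorphic_map (subtopology (man_top M) U)
          (subtopology (Euclidean_space (man_dim M)) (\<phi> ` U)) \<phi>) \<and>
     (\<forall>(U, \<phi>)\<in>man_atlas M. \<forall>(V, \<psi>)\<in>man_atlas M. \<forall>j<man_dim M.
        smooth_coord (man_dim M) (\<phi> ` (U \<inter> V)) (\<lambda>z. \<psi> (inv_into U \<phi> z) j))"

definition prod_chart ::
  "nat \<Rightarrow> 'a set \<times> ('a \<Rightarrow> nat \<Rightarrow> real) \<Rightarrow> 'b set \<times> ('b \<Rightarrow> nat \<Rightarrow> real) \<Rightarrow>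
   ('a \<times> 'b) set \<times> ('a \<times> 'b \<Rightarrow> nat \<Rightarrow> real)"
where
  "prod_chart d a b =
     (fst a \<times> fst b, \<lambda>(x, y) i. if i < d then snd a x i else snd b y (i - d))"

definition prod_manifold :: "'a manifold \<Rightarrow> 'b manifold \<Rightarrow> ('a \<times> 'b) manifold" where
  "prod_manifold M N =
     \<lparr>man_dim = man_dim M + man_dim N,
      man_top = prod_topology (man_top M) (man_top N),
      man_atlas = {prod_chart (man_dim M) a b | a b. a \<in> man_atlas M \<and> b \<in> man_atlas N}\<rparr>"

definition smooth_map :: "'a manifold \<Rightarrow> 'b manifold \<Rightarrow> ('a \<Rightarrow> 'b) \<Rightarrow> bool" where
  "smooth_map M N f \<longleftrightarrow>
     continuous_map (man_top M) (man_top N) f \<and>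
     (\<forall>(U, \<phi>)\<in>man_atlas M. \<forall>(V, \<psi>)\<in>man_atlas N. \<forall>j<man_dim N.
        smooth_coord (man_dim M) (\<phi> ` (U \<inter> f -` V)) (\<lambda>z. \<psi> (f (inv_into U \<phi> z)) j))"

definition lie_group :: "'a monoid \<Rightarrow> 'a manifold \<Rightarrow> bool" where
  "lie_group G M \<longleftrightarrow>
     group G \<and> smooth_manifold M \<and> topspace (man_top M) = carrier G \<and>
     smooth_map (prod_manifold M M) M (\<lambda>(x, y). x \<otimes>\<^bsub>G\<^esub> y) \<and>
     smooth_map M M (\<lambda>x. inv\<^bsub>G\<^esub> x)"

text \<open>
  Smoothness of a map into a finite-dimensional real vector space, tested on real linear
  functionals. Since \<open>SO(n)\<close>, \<open>GL\<^sub>k(\<complex>)\<close> and the image of \<open>spinc_incl\<close> are embedded submanifolds of the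
  surrounding vector spaces, this is also smoothness of maps into these Lie groups.
\<close>

definition smooth_into_vector_space :: "'a manifold \<Rightarrow> ('a \<Rightarrow> 'v::real_vector) \<Rightarrow> bool" where
  "smooth_into_vector_space M h \<longleftrightarrow>
     (\<forall>l :: 'v \<Rightarrow> real. linear l \<longrightarrow>
        (\<forall>(U, \<phi>)\<in>man_atlas M. smooth_coord (man_dim M) (\<phi> ` U) (\<lambda>z. l (h (inv_into U \<phi> z)))))"

end

theory Submission
  imports Defs "HOL-Computational_Algebra.Fundamental_Theorem_Algebra"
begin

text \<open>
  \<^bold>\<open>Why part (1) holds.\<close> For a unit vector \<open>v\<close> the relation \<open>v * v = -1\<close> makes \<open>y \<mapsto> v * y * v\<close> the
  reflection in the hyperplane orthogonal to \<open>v\<close> (\<open>clifford_vec_conj\<close>). The inverse of an even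
  product \<open>v\<^sub>1 \<cdots> v\<^sub>l\<close> is \<open>v\<^sub>l \<cdots> v\<^sub>1\<close>, so conjugation by it acts on vectors as a product of \<open>l\<close>
  reflections, which is a rotation. Conjugation and the automorphism induced by this rotation are
  two algebra automorphisms that agree on vectors, and vectors generate, so they agree everywhere.
  Applying \<open>\<rho>\<close> gives the formula.

  \<^bold>\<open>Why part (2) holds.\<close> Every rotation is a product of an even number of reflections
  (Cartan--Dieudonne), so \<open>p' A = Ad [x, 1]\<close> for some \<open>x\<close> in the spin group. Then \<open>\<rho>(x)\<inverse> \<epsilon>'(A)\<close>
  commutes with the image of \<open>\<rho>\<close>, and Schur's lemma makes it a scalar \<open>c\<close>. So \<open>\<epsilon>'(A) = \<rho>(c x)\<close>,
  and \<open>[x, c]\<close> is the value of \<open>f\<close> at \<open>A\<close> (\<open>SpinC_lift\<close>).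

  Uniqueness, multiplicativity and smoothness of \<open>f\<close> all come from one fact: \<open>\<rho>\<close> is injective on
  the even part of the complex Clifford algebra (\<open>rep_injective_on_even\<close>), where the group lies.
  Since moreover the element \<open>c A\<close> determines the class \<open>[A, c]\<close> (\<open>spinc_incl_injective\<close>), \<open>\<epsilon>\<close> is
  injective, so that \<open>\<epsilon>' = \<epsilon> \<circ> f\<close> determines \<open>f\<close> and forces it to be a homomorphism. The
  injectivity also provides a linear map \<open>L\<close> that inverts \<open>\<rho>\<close> on the even part, so that \<open>f = L \<circ> \<epsilon>'\<close> is as smooth
  as \<open>\<epsilon>'\<close>.

  The injectivity is an induction on the number of generators. If \<open>x\<close> is even and involves those
  in \<open>S \<union> {i}\<close>, then \<open>x = a + e\<^sub>i b\<close> with \<open>a\<close> even and \<open>b\<close> odd in the generators in \<open>S\<close>.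
  Conjugation by \<open>e\<^sub>i\<close> fixes \<open>a\<close> and negates \<open>e\<^sub>i b\<close>, so if \<open>x\<close> lies in an ideal then so do \<open>a\<close>
  and \<open>b\<close>. By induction on \<open>S\<close>, an ideal without nonzero scalars, such as the kernel of \<open>\<rho>\<close>,
  contains no nonzero even element.
\<close>

section \<open>Complex matrices\<close>

lemma mat_mult_left: "mat c ** A = (\<chi> i. c *s A $ i)" for A :: "'a::comm_semiring_1 ^ 'n ^ 'm"
  by (simp add: vec_eq_iff matrix_matrix_mult_def mat_def if_distrib[of "\<lambda>x. x * _"] cong: if_cong)

lemma mat_mult_right: "A ** mat c = (\<chi> i. c *s A $ i)" for A :: "'a::comm_semiring_1 ^ 'n ^ 'm"
  by (simp add: vec_eq_iff matrix_matrix_mult_def mat_def if_distrib[of "\<lambda>x. _ * x"] mult.commute cong: if_cong)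

lemma matrix_inv_left:
  assumes "invertible A"
  shows "matrix_inv A ** A = mat 1"
proof -
  have "A ** matrix_inv A = mat 1 \<and> matrix_inv A ** A = mat 1"
    unfolding matrix_inv_def by (rule someI_ex) (use assms in \<open>simp add: invertible_def\<close>)
  then show ?thesis ..
qed

lemma matrix_inv_eqI:
  fixes A B :: "'a::field ^ 'n ^ 'n"
  assumes "A ** B = mat 1"
  shows "matrix_inv A = B"
proof -
  have "invertible A" using assms invertible_right_inverse by blast
  then have "matrix_inv A ** A = mat 1"
    by (rule matrix_inv_left)
  then show ?thesis
    by (metis assms matrix_mul_assoc matrix_mul_lid matrix_mul_rid)
qed

text \<open>
  The determinant is a polynomial in the entries, so it commutes with evaluation.
\<close>

lemma poly_det: "poly (det M) z = det (\<chi> i j. poly (M $ i $ j) z)"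
  for M :: "'a::comm_ring_1 poly ^ 'k ^ 'k"
proof -
  have "poly (of_int m) z = of_int m" for m :: int
    by (cases m rule: int_cases2) auto
  then show ?thesis
    unfolding det_def poly_sum by (simp add: poly_prod)
qed

text \<open>
  If \<open>M\<close> had no eigenvalue, the characteristic polynomial would be a constant \<open>d\<close> by the
  fundamental theorem of algebra. Its reversal \<open>det (w M - 1)\<close> would then be \<open>d w\<^sup>k\<close> for \<open>w \<noteq> 0\<close>,
  hence also for \<open>w = 0\<close>, where the one side is \<open>\<plusminus>1\<close> and the other \<open>0\<close>.
\<close>

lemma complex_matrix_eigenvalue:
  fixes M :: "complex ^ 'k ^ 'k"
  obtains c v where "v \<noteq> 0" "M *v v = c *s v"
proof -
  have "\<exists>c. \<not> invertible (M - mat c)"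
  proof (rule ccontr)
    assume "\<not> ?thesis"
    then have inv: "det (M - mat c) \<noteq> 0" for c
      by (metis invertible_det_nz)
    let ?p = "det (\<chi> i j. [:M $ i $ j, if i = j then - 1 else 0:])"
    let ?q = "det (\<chi> i j. [:if i = j then - 1 else 0, M $ i $ j:])"
    have p: "poly ?p c = det (M - mat c)" for c
      unfolding poly_det by (rule arg_cong[of _ _ det]) (simp add: vec_eq_iff mat_def)
    have "constant (poly ?p)"
      using fundamental_theorem_of_algebra[of ?p] inv p by auto
    then obtain d where d: "det (M - mat c) = d" for c
      unfolding constant_def p by metis
    have q: "poly ?q w = d * w ^ CARD('k)" if "w \<noteq> 0" for w
    proof -
      have "poly ?q w = det (\<chi> i. w *s (M - mat (1 / w)) $ i)"
        unfolding poly_det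
        by (rule arg_cong[of _ _ det]) (use that in \<open>simp add: vec_eq_iff mat_def field_simps\<close>)
      also have "\<dots> = w ^ CARD('k) * det (M - mat (1 / w))"
        by (subst det_rows_mul) simp
      finally show ?thesis by (simp add: d)
    qed
    have "infinite (UNIV - {0::complex})"
      by (rule Diff_infinite_finite) (simp_all add: infinite_UNIV_char_0)
    moreover have "UNIV - {0} \<subseteq> {w. poly (?q - monom d CARD('k)) w = 0}"
      using q by (auto simp: poly_monom)
    ultimately have "?q - monom d CARD('k) = 0"
      using poly_roots_finite finite_subset by blast
    then have "poly ?q 0 = 0"
      by (simp add: poly_monom)
    moreover have "poly ?q 0 = det (mat (- 1) :: complex ^ 'k ^ 'k)"
      unfolding poly_det by (rule arg_cong[of _ _ det]) (simp add: vec_eq_iff mat_def)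
    moreover have "\<dots> = (- 1) ^ CARD('k)"
      by (subst det_diagonal) (auto simp: mat_def)
    ultimately show False by simp
  qed
  then obtain c where "\<not> invertible (M - mat c)" by auto
  then obtain v where "v \<noteq> 0" "(M - mat c) *v v = 0"
    unfolding invertible_left_inverse matrix_left_invertible_ker by auto
  moreover have "mat c *v v = c *s v"
    by (simp add: vec_eq_iff matrix_vector_mult_def mat_def if_distrib[of "\<lambda>x. x * _"] cong: if_cong)
  ultimately show thesis
    using that by (simp add: matrix_vector_mult_diff_rdistrib)
qed

section \<open>Orthogonal matrices as products of reflections\<close>

definition reflection :: "real ^ 'n::finite \<Rightarrow> real ^ 'n ^ 'n" where
  "reflection v = mat 1 - (\<chi> i j. 2 * (v $ i * v $ j))"

lemma reflection_mult_vec: "reflection v *v y = y - (2 * (v \<bullet> y)) *\<^sub>R v"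
proof -
  have "(\<chi> i j. 2 * (v $ i * v $ j)) *v y = (2 * (v \<bullet> y)) *\<^sub>R v"
    by (simp add: vec_eq_iff matrix_vector_mult_def inner_vec_def sum_distrib_left sum_distrib_right mult_ac)
  then show ?thesis
    by (simp add: reflection_def matrix_vector_mult_diff_rdistrib)
qed

lemma orthogonal_matrix_inner:
  "orthogonal_matrix B \<longleftrightarrow> (\<forall>x y. (B *v x) \<bullet> (B *v y) = x \<bullet> y)" for B :: "real ^ 'n ^ 'n"
  using orthogonal_transformation_matrix[of "(*v) B"]
  by (simp add: orthogonal_transformation_def)

lemma orthogonal_reflection:
  assumes "norm v = 1"
  shows "orthogonal_matrix (reflection v)"
proof -
  have "v \<bullet> v = 1" using assms by (simp add: norm_eq_1)
  then show ?thesis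
    unfolding orthogonal_matrix_inner reflection_mult_vec
    by (simp add: inner_diff inner_commute algebra_simps)
qed

lemma matrix_eqI: "(\<And>x. A *v x = B *v x) \<Longrightarrow> A = B" for A B :: "real ^ 'n ^ 'm"
  by (simp add: matrix_eq)

lemma reflection_involution:
  assumes "norm v = 1"
  shows "reflection v ** reflection v = mat 1"
proof (rule matrix_eqI)
  have "v \<bullet> v = 1" using assms by (simp add: norm_eq_1)
  then show "(reflection v ** reflection v) *v x = mat 1 *v x" for x
    by (simp add: reflection_mult_vec inner_diff flip: matrix_vector_mul_assoc)
qed

text \<open>
  An orthogonal change of basis takes \<open>v\<close> to a basis vector, where the reflection is diagonal.
\<close>

lemma det_reflection:
  fixes v :: "real ^ 'n::finite"
  assumes "norm v = 1"
  shows "det (reflection v) = - 1"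
proof -
  fix k :: 'n
  obtain A where A: "orthogonal_matrix A" "A *v axis k 1 = v"
    using orthogonal_matrix_exists_basis[OF assms] .
  have "reflection v ** A = A ** reflection (axis k 1)"
  proof (rule matrix_eqI)
    fix x
    have "v \<bullet> (A *v x) = axis k 1 \<bullet> x"
      using A unfolding orthogonal_matrix_inner by metis
    then show "(reflection v ** A) *v x = (A ** reflection (axis k 1)) *v x"
      by (simp add: reflection_mult_vec A(2) matrix_vector_mult_diff_distrib matrix_vector_mult_scaleR
          flip: matrix_vector_mul_assoc)
  qed
  then have "det (reflection v) * det A = det A * det (reflection (axis k 1))"
    by (metis det_mul)
  moreover have "det A \<noteq> 0"
    using det_orthogonal_matrix[OF A(1)] by auto
  moreover have "det (reflection (axis k 1 :: real ^ 'n)) = - 1"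
  proof -
    have "reflection (axis k 1) $ i $ j = (if i = j then if i = k then - 1 else 1 else 0)" for i j
      by (simp add: reflection_def mat_def axis_def)
    then have "det (reflection (axis k 1)) = (\<Prod>i\<in>UNIV. if i = k then - 1 else (1::real))"
      by (subst det_diagonal) auto
    also have "\<dots> = - 1"
      by (subst prod.delta) auto
    finally show ?thesis .
  qed
  ultimately show ?thesis
    by (metis mult.commute mult_cancel_left mult_minus1_right)
qed

definition reflections :: "(real ^ 'n::finite) list \<Rightarrow> real ^ 'n ^ 'n" where
  "reflections vs = foldr (\<lambda>v. (**) (reflection v)) vs (mat 1)"

lemma reflections_simps [simp]:
  "reflections [] = mat 1"
  "reflections (v # vs) = reflection v ** reflections vs"
  by (simp_all add: reflections_def)

lemma reflections_append: "reflections (vs @ ws) = reflections vs ** reflections ws"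
  by (induction vs) (simp_all add: matrix_mul_assoc)

lemma orthogonal_reflections:
  "\<forall>v\<in>set vs. norm v = 1 \<Longrightarrow> orthogonal_matrix (reflections vs)"
  by (induction vs) (auto simp: orthogonal_matrix_id orthogonal_matrix_mul orthogonal_reflection)

lemma det_reflections:
  "\<forall>v\<in>set vs. norm v = 1 \<Longrightarrow> det (reflections vs) = (- 1) ^ length vs"
  by (induction vs) (auto simp: det_mul det_reflection)

text \<open>
  The induction is on a set \<open>S\<close> outside which \<open>B\<close> fixes the basis vectors. If \<open>B\<close> moves \<open>e\<^sub>i\<close>, the
  reflection along \<open>B e\<^sub>i - e\<^sub>i\<close> takes \<open>B e\<^sub>i\<close> back to \<open>e\<^sub>i\<close>, and it keeps every \<open>e\<^sub>j\<close> that \<open>B\<close>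
  already fixes, since \<open>B\<close> preserves the inner product of \<open>e\<^sub>i\<close> and \<open>e\<^sub>j\<close>.
\<close>

lemma orthogonal_matrix_product_of_reflections_aux:
  fixes B :: "real ^ 'n ^ 'n"
  assumes "finite S" "orthogonal_matrix B" "\<And>i. i \<notin> S \<Longrightarrow> B *v axis i 1 = axis i 1"
  shows "\<exists>vs. (\<forall>v\<in>set vs. norm v = 1) \<and> B = reflections vs"
  using assms
proof (induction S arbitrary: B rule: finite_induct)
  case empty
  have "column i B = column i (mat 1)" for i
    using empty.prems(2)[of i] by (simp flip: matrix_vector_mult_basis)
  then have "B = mat 1"
    by (simp add: vec_eq_iff column_def)
  then show ?case by (intro exI[of _ "[]"]) simp
next
  case (insert i S)
  show ?case
  proof (cases "B *v axis i 1 = axis i 1")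
    case True
    then show ?thesis using insert by (metis insert_iff)
  next
    case False
    define w where "w = B *v axis i 1 - axis i 1"
    define v where "v = w /\<^sub>R norm w"
    have w: "norm w \<noteq> 0" using False by (simp add: w_def)
    then have v: "norm v = 1" by (simp add: v_def)
    have inner: "(B *v x) \<bullet> (B *v y) = x \<bullet> y" for x y
      using insert.prems(1) by (simp add: orthogonal_matrix_inner)
    have "(reflection v ** B) *v axis j 1 = axis j 1" if "j \<notin> S" for j
    proof (cases "j = i")
      case True
      have ww: "w \<bullet> w = 2 * (w \<bullet> (B *v axis i 1))"
        unfolding w_def by (simp add: inner_diff inner inner_commute)
      have "(2 * (v \<bullet> (B *v axis i 1))) *\<^sub>R v = ((2 * (w \<bullet> (B *v axis i 1))) / (w \<bullet> w)) *\<^sub>R w"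
        by (simp add: v_def dot_square_norm power2_eq_square divide_inverse mult_ac)
      also have "\<dots> = w"
        using w unfolding ww[symmetric] by simp
      finally show ?thesis
        by (simp add: True reflection_mult_vec w_def flip: matrix_vector_mul_assoc)
    next
      case False
      then have Bj: "B *v axis j 1 = axis j 1"
        using insert.prems(2) that by simp
      have "w \<bullet> axis j 1 = (B *v axis i 1) \<bullet> (B *v axis j 1) - axis i 1 \<bullet> (axis j 1 :: real ^ 'n)"
        by (simp add: w_def Bj inner_diff)
      then have "v \<bullet> axis j 1 = 0"
        by (simp add: inner v_def)
      then show ?thesis
        by (simp add: Bj reflection_mult_vec flip: matrix_vector_mul_assoc)
    qed
    moreover have "orthogonal_matrix (reflection v ** B)"
      by (simp add: insert.prems(1) orthogonal_matrix_mul orthogonal_reflection v)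
    ultimately obtain vs where "\<forall>v\<in>set vs. norm v = 1" "reflection v ** B = reflections vs"
      using insert.IH by blast
    moreover from this have "B = reflections (v # vs)"
      by (metis matrix_mul_assoc matrix_mul_lid reflection_involution reflections_simps(2) v)
    ultimately show ?thesis using v by (metis set_ConsD)
  qed
qed

lemma orthogonal_matrix_product_of_reflections:
  fixes B :: "real ^ 'n ^ 'n"
  assumes "orthogonal_matrix B"
  obtains vs where "\<forall>v\<in>set vs. norm v = 1" "B = reflections vs"
  using orthogonal_matrix_product_of_reflections_aux[of UNIV B] assms by auto

section \<open>Products of unit vectors in the Clifford algebra\<close>

lemma clifford_vec_add: "clifford_vec (v + w) = clifford_vec v + clifford_vec w"
  by transfer (simp add: tensor_vec_add clifford_eq_def clifford_ideal_0)

lemma clifford_vec_scaleR: "clifford_vec (r *\<^sub>R v) = r *\<^sub>R clifford_vec v"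
  by transfer (simp add: tensor_vec_scaleR clifford_eq_def clifford_ideal_0)

lemma linear_clifford_vec: "linear clifford_vec"
  by (rule linearI) (simp_all add: clifford_vec_add clifford_vec_scaleR)

text \<open>
  The Clifford square of \<open>v\<close> is the scalar \<open>- (v \<bullet> v)\<close>, which vanishes only for \<open>v = 0\<close>.
\<close>

lemma inj_clifford_vec: "inj clifford_vec"
  unfolding linear_injective_0[OF linear_clifford_vec]
proof (intro allI impI)
  fix v :: "real ^ 'n"
  assume "clifford_vec v = 0"
  then have "(v \<bullet> v) *\<^sub>R (1 :: 'n clifford) = 0"
    using clifford_vec_square[of v] by simp
  then show "v = 0" by simp
qed

text \<open>
  This is the polarization of \<open>clifford_vec_square\<close>.
\<close>

lemma clifford_vec_anticommute:
  "clifford_vec v * clifford_vec w + clifford_vec w * clifford_vec v = - ((2 * (v \<bullet> w)) *\<^sub>R 1)"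
proof -
  have "(v + w) \<bullet> (v + w) = v \<bullet> v + 2 * (v \<bullet> w) + w \<bullet> w"
    by (simp add: inner_add inner_commute)
  then show ?thesis
    using clifford_vec_square[of "v + w"]
    by (simp add: clifford_vec_add clifford_vec_square distrib_left distrib_right scaleR_add_left
        add.commute)
qed

text \<open>
  Since \<open>v\<inverse> = - v\<close>, this is minus the conjugation by \<open>v\<close>; the signs cancel in even products.
\<close>

lemma clifford_vec_conj:
  assumes "norm v = 1"
  shows "clifford_vec v * clifford_vec y * clifford_vec v = clifford_vec (reflection v *v y)"
proof -
  have "v \<bullet> v = 1" using assms by (simp add: norm_eq_1)
  then have sq: "clifford_vec v * clifford_vec v = - 1"
    by (simp add: clifford_vec_square)
  have "clifford_vec y * clifford_vec v = - ((2 * (v \<bullet> y)) *\<^sub>R 1) - clifford_vec v * clifford_vec y"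
    using clifford_vec_anticommute[of v y] by (simp add: algebra_simps)
  then have "clifford_vec v * clifford_vec y * clifford_vec v
      = clifford_vec v * (- ((2 * (v \<bullet> y)) *\<^sub>R 1) - clifford_vec v * clifford_vec y)"
    by (simp add: mult.assoc)
  also have "\<dots> = clifford_vec (reflection v *v y)"
    by (simp add: right_diff_distrib sq flip: mult.assoc)
      (simp add: reflection_mult_vec linear_diff[OF linear_clifford_vec] clifford_vec_scaleR)
  finally show ?thesis .
qed

definition clifford_prod :: "(real ^ 'n) list \<Rightarrow> 'n::finite clifford" where
  "clifford_prod vs = prod_list (map clifford_vec vs)"

lemma clifford_prod_simps [simp]:
  "clifford_prod [] = 1"
  "clifford_prod (v # vs) = clifford_vec v * clifford_prod vs"
  "clifford_prod (vs @ ws) = clifford_prod vs * clifford_prod ws"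
  by (simp_all add: clifford_prod_def)

text \<open>
  Cancelling from the middle outwards, each \<open>v * v\<close> contributes a factor \<open>-1\<close>. So for even
  products of unit vectors, reversal is inversion.
\<close>

lemma clifford_prod_rev:
  assumes "\<forall>v\<in>set vs. norm v = 1"
  shows "clifford_prod vs * clifford_prod (rev vs) = (- 1) ^ length vs"
  using assms
proof (induction vs)
  case (Cons v vs)
  then have "v \<bullet> v = 1" by (simp add: norm_eq_1)
  then have sq: "clifford_vec v * clifford_vec v = - 1"
    by (simp add: clifford_vec_square)
  have "clifford_prod (v # vs) * clifford_prod (rev (v # vs))
      = clifford_vec v * (clifford_prod vs * clifford_prod (rev vs)) * clifford_vec v"
    by (simp add: mult.assoc)
  also have "\<dots> = clifford_vec v * ((- 1) ^ length vs) * clifford_vec v"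
    using Cons by simp
  also have "\<dots> = (- 1) ^ length (v # vs)"
    by (cases "even (length vs)") (simp_all add: sq)
  finally show ?case .
qed simp

lemma clifford_prod_inverse:
  assumes "even (length vs)" "\<forall>v\<in>set vs. norm v = 1"
  shows "clifford_prod vs * clifford_prod (rev vs) = 1" "clifford_prod (rev vs) * clifford_prod vs = 1"
  using clifford_prod_rev[of vs] clifford_prod_rev[of "rev vs"] assms by simp_all

lemma clifford_prod_conj:
  assumes "\<forall>v\<in>set vs. norm v = 1"
  shows "clifford_prod vs * clifford_vec y * clifford_prod (rev vs) = clifford_vec (reflections vs *v y)"
  using assms
proof (induction vs)
  case (Cons v vs)
  have "clifford_prod (v # vs) * clifford_vec y * clifford_prod (rev (v # vs))
      = clifford_vec v * (clifford_prod vs * clifford_vec y * clifford_prod (rev vs)) * clifford_vec v"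
    by (simp add: mult.assoc)
  also have "\<dots> = clifford_vec v * clifford_vec (reflections vs *v y) * clifford_vec v"
    using Cons by simp
  also have "\<dots> = clifford_vec (reflection v *v (reflections vs *v y))"
    by (rule clifford_vec_conj) (use Cons.prems in simp)
  finally show ?case by (simp add: matrix_vector_mul_assoc)
qed simp

text \<open>
  The basis vectors generate the algebra: in the tensor algebra every word is obtained from the
  empty one by multiplying letters on the left.
\<close>

lemma clifford_induct [case_names scalar add vec_mult]:
  fixes x :: "'n::finite clifford"
  assumes scalar: "\<And>r. P (of_real r)"
    and add: "\<And>x y. P x \<Longrightarrow> P y \<Longrightarrow> P (x + y)"
    and vec_mult: "\<And>i x. P x \<Longrightarrow> P (clifford_vec (axis i 1) * x)"
  shows "P x"
proof -
  obtain p where x: "x = abs_clifford p"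
    by (metis Quotient3_abs_rep[OF Quotient3_clifford])
  have "P (abs_clifford p)"
  proof (induction p rule: poly_mapping_add_induct)
    case (single w r)
    show ?case
    proof (induction w)
      case Nil
      have "Poly_Mapping.single [] r = r *\<^sub>R (1 :: 'n tensor_algebra)"
        by (simp add: scaleR_single zero_list_def flip: single_one)
      then have "abs_clifford (Poly_Mapping.single [] r) = (of_real r :: 'n clifford)"
        by (simp add: of_real_def one_clifford.abs_eq scaleR_clifford.abs_eq)
      then show ?case using scalar by simp
    next
      case (Cons i w)
      have "tensor_vec (axis i 1) = (\<Sum>j\<in>UNIV. if j = i then Poly_Mapping.single [i] 1 else 0)"
        unfolding tensor_vec_def by (intro sum.cong) (auto simp: axis_def)
      then have "tensor_vec (axis i 1) = Poly_Mapping.single [i] 1"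
        by simp
      then have "Poly_Mapping.single (i # w) r = tensor_vec (axis i 1) * Poly_Mapping.single w r"
        by (simp add: mult_single plus_list_def)
      then show ?case
        using vec_mult[OF Cons.IH, of i] by (simp add: clifford_vec.abs_eq times_clifford.abs_eq)
    qed
  next
    case (add p q)
    then show ?case using assms(2) by (simp flip: plus_clifford.abs_eq)
  qed
  then show ?thesis by (simp add: x)
qed

text \<open>
  Both sides are algebra homomorphisms in \<open>x\<close> that agree on vectors, by \<open>clifford_prod_conj\<close>.
\<close>

lemma clifford_map_reflections:
  assumes "even (length vs)" "\<forall>v\<in>set vs. norm v = 1"
  shows "clifford_map (reflections vs) x = clifford_prod vs * x * clifford_prod (rev vs)"
proof (induction x rule: clifford_induct)
  case (scalar r)
  then show ?case
    by (simp add: of_real_def clifford_map_hom orthogonal_reflections assms clifford_prod_inverse)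
next
  case (add x y)
  then show ?case
    by (simp add: clifford_map_hom orthogonal_reflections assms algebra_simps)
next
  case (vec_mult i x)
  have "clifford_map (reflections vs) (clifford_vec (axis i 1) * x)
      = clifford_vec (reflections vs *v axis i 1) * (clifford_prod vs * x * clifford_prod (rev vs))"
    by (simp add: clifford_map_hom clifford_map_vec orthogonal_reflections assms vec_mult)
  also have "\<dots> = clifford_prod vs * clifford_vec (axis i 1) * (clifford_prod (rev vs) * clifford_prod vs)
      * x * clifford_prod (rev vs)"
    by (simp only: clifford_prod_conj[OF assms(2), symmetric] mult.assoc)
  finally show ?case
    by (simp add: clifford_prod_inverse assms mult.assoc)
qed

section \<open>The complexified Clifford algebra and its even part\<close>

lemmas complexified_simps =
  zero_complexified_def one_complexified_def uminus_complexified_def plus_complexified_def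
  minus_complexified_def times_complexified_def scaleR_complexified_def

lemma complexify_hom [simp]:
  "complexify 0 = 0"
  "complexify 1 = 1"
  "complexify (- a) = - complexify a"
  "complexify (a + b) = complexify a + complexify b"
  "complexify (a * b) = complexify a * complexify b"
  "complexify (r *\<^sub>R a) = r *\<^sub>R complexify a"
  by (simp_all add: complexify_def complexified_simps)

lemma complexify_inject [simp]: "complexify a = complexify b \<longleftrightarrow> a = b"
  by (simp add: complexify_def)

lemma cx_scalar_hom [simp]:
  "cx_scalar 0 = 0"
  "cx_scalar 1 = 1"
  "cx_scalar (- c) = - cx_scalar c"
  "cx_scalar (of_real r) = of_real r"
  "cx_scalar (c + d) = cx_scalar c + cx_scalar d"
  "cx_scalar (c * d) = cx_scalar c * cx_scalar d"
  by (simp_all add: cx_scalar_def of_real_def complexified_simps algebra_simps)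

lemma cx_scalar_commute: "cx_scalar c * x = x * cx_scalar c"
  by (simp add: cx_scalar_def of_real_def complexified_simps algebra_simps)

lemma cx_scalar_mult_mult:
  "cx_scalar a * x * (cx_scalar b * y) = cx_scalar (a * b) * (x * y)"
proof -
  have "cx_scalar a * x * (cx_scalar b * y) = cx_scalar a * (x * cx_scalar b) * y"
    by (simp add: mult.assoc)
  then show ?thesis
    by (simp only: cx_scalar_commute[of b x, symmetric] cx_scalar_hom mult.assoc)
qed

lemma cclifford_vec_add: "cclifford_vec (v + w) = cclifford_vec v + cclifford_vec w"
  by (simp add: cclifford_vec_def clifford_vec_add)

lemma cclifford_vec_scaleR: "cclifford_vec (r *\<^sub>R v) = r *\<^sub>R cclifford_vec v"
  by (simp add: cclifford_vec_def clifford_vec_scaleR)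

lemma linear_cclifford_vec: "linear cclifford_vec"
  by (rule linearI) (simp_all add: cclifford_vec_add cclifford_vec_scaleR)

lemma cclifford_map_reflections:
  assumes "even (length vs)" "\<forall>v\<in>set vs. norm v = 1"
  shows "cclifford_map (reflections vs) x
     = complexify (clifford_prod vs) * x * complexify (clifford_prod (rev vs))"
proof (cases x)
  case (Cx a b)
  then show ?thesis
    by (simp add: cclifford_map_def clifford_map_reflections[OF assms] complexify_def complexified_simps)
qed

definition gen :: "'n::finite \<Rightarrow> 'n cclifford" where
  "gen i = cclifford_vec (axis i 1)"

lemma gen_square: "gen i * gen i = - 1"
  by (simp add: gen_def cclifford_vec_def clifford_vec_square inner_axis flip: complexify_hom)

lemma gen_anticommute:
  fixes i j :: "'n::finite"
  assumes "i \<noteq> j"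
  shows "gen i * gen j = - (gen j * gen i)"
proof -
  have "(axis i 1 :: real ^ 'n) \<bullet> axis j 1 = 0"
    using assms by (simp add: inner_axis_axis)
  then have "clifford_vec (axis i 1) * clifford_vec (axis j 1)
     = - (clifford_vec (axis j 1) * clifford_vec (axis i (1::real)) :: 'n clifford)"
    using clifford_vec_anticommute[of "axis i 1" "axis j 1"]
    by (simp add: eq_neg_iff_add_eq_0)
  then show ?thesis
    by (simp add: gen_def cclifford_vec_def flip: complexify_hom)
qed

text \<open>
  The complex span of the monomials in the generators \<open>e\<^sub>i\<close>, \<open>i \<in> S\<close>, of even (\<open>p\<close>) or odd (\<open>\<not> p\<close>)
  degree. The letters of a monomial may repeat and come in any order; \<open>graded_insert_decompose\<close>
  below sorts out one generator at a time.
\<close>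

inductive graded :: "'n::finite set \<Rightarrow> bool \<Rightarrow> 'n cclifford \<Rightarrow> bool" for S where
  scalar: "graded S True (cx_scalar c)"
| zero: "graded S p 0"
| add: "graded S p x \<Longrightarrow> graded S p y \<Longrightarrow> graded S p (x + y)"
| gen_mult: "i \<in> S \<Longrightarrow> graded S p x \<Longrightarrow> graded S (\<not> p) (gen i * x)"

lemma graded_scalar_mult: "graded S p x \<Longrightarrow> graded S p (cx_scalar c * x)"
proof (induction rule: graded.induct)
  case (scalar d)
  then show ?case using graded.scalar[of S "c * d"] by simp
next
  case (add p x y)
  then show ?case by (simp add: distrib_left graded.add)
next
  case (gen_mult i p x)
  then have "graded S (\<not> p) (gen i * (cx_scalar c * x))"
    by (blast intro: graded.gen_mult)
  then show ?case by (metis cx_scalar_commute mult.assoc)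
qed (simp add: graded.zero)

lemma graded_scaleR: "graded S p x \<Longrightarrow> graded S p (r *\<^sub>R x)"
  using graded_scalar_mult[of S p x "of_real r"] by (simp add: scaleR_conv_of_real)

lemma subspace_graded: "subspace {x. graded S p x}"
  by (simp add: subspace_def graded.zero graded.add graded_scaleR)

lemma graded_vec_mult:
  assumes "graded UNIV p x"
  shows "graded UNIV (\<not> p) (cclifford_vec v * x)"
proof -
  have "cclifford_vec v = cclifford_vec (\<Sum>i\<in>UNIV. (v $ i) *\<^sub>R axis i 1)"
    by (rule arg_cong[of _ _ cclifford_vec]) (metis basis_expansion scalar_mult_eq_scaleR)
  also have "\<dots> = (\<Sum>i\<in>UNIV. (v $ i) *\<^sub>R gen i)"
    by (simp add: linear_sum[OF linear_cclifford_vec] cclifford_vec_scaleR gen_def)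
  finally have "cclifford_vec v * x = (\<Sum>i\<in>UNIV. (v $ i) *\<^sub>R (gen i * x))"
    by (simp add: sum_distrib_right)
  moreover have "graded UNIV (\<not> p) (\<Sum>i\<in>I. (v $ i) *\<^sub>R (gen i * x))" if "finite I" for I
    using that
    by induction (auto intro!: graded.intros graded_scaleR assms)
  ultimately show ?thesis by simp
qed

lemma graded_clifford_prod: "graded UNIV (even (length vs)) (complexify (clifford_prod vs))"
proof (induction vs)
  case Nil
  show ?case using graded.scalar[of UNIV 1] by simp
next
  case (Cons v vs)
  then show ?case
    using graded_vec_mult[OF Cons.IH, of v] by (simp add: cclifford_vec_def)
qed

text \<open>
  Moving every \<open>e\<^sub>i\<close> to the front and reducing with \<open>e\<^sub>i * e\<^sub>i = -1\<close> leaves at most one of them.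
\<close>

lemma graded_insert_decompose:
  assumes "graded (insert i S) p x"
  shows "\<exists>a b. graded S p a \<and> graded S (\<not> p) b \<and> x = a + gen i * b"
  using assms
proof (induction rule: graded.induct)
  case (scalar c)
  then show ?case using graded.scalar[of S c] graded.zero[of S] by force
next
  case (zero p)
  then show ?case using graded.zero[of S] by force
next
  case (add p x y)
  then obtain a b c d where "graded S p a" "graded S (\<not> p) b" "graded S p c" "graded S (\<not> p) d"
    "x = a + gen i * b" "y = c + gen i * d" by blast
  then show ?case
    by (intro exI[of _ "a + c"] exI[of _ "b + d"]) (simp add: graded.add algebra_simps)
next
  case (gen_mult j p x)
  then obtain a b where ab: "graded S p a" "graded S (\<not> p) b" "x = a + gen i * b" by blast
  have minus: "graded S q (- y)" if "graded S q y" for q y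
    using graded_scaleR[OF that, of "- 1"] by simp
  show ?case
  proof (cases "j = i")
    case True
    have "gen j * x = - b + gen i * a"
      using ab(3) True by (simp add: distrib_left gen_square flip: mult.assoc)
    then show ?thesis
      using ab by (intro exI[of _ "- b"] exI[of _ a]) (simp add: minus)
  next
    case False
    then have j: "j \<in> S" using gen_mult by simp
    have "gen j * gen i * b = - (gen i * gen j) * b"
      using gen_anticommute[OF False] by simp
    then have "gen j * x = gen j * a + gen i * - (gen j * b)"
      using ab(3) by (simp add: distrib_left mult.assoc)
    then show ?thesis using ab j graded.gen_mult minus by blast
  qed
qed

text \<open>
  Moving \<open>e\<^sub>i\<close> past a monomial in other generators costs one sign for each letter.
\<close>

lemma graded_commute_gen:
  assumes "graded S p x" "i \<notin> S"
  shows "gen i * x = (if p then x * gen i else - (x * gen i))"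
  using assms
proof (induction rule: graded.induct)
  case (scalar c)
  then show ?case by (simp add: cx_scalar_commute)
next
  case (gen_mult j p x)
  then have "gen i * gen j = - (gen j * gen i)"
    by (intro gen_anticommute) auto
  then have "gen i * (gen j * x) = - (gen j * (gen i * x))"
    by (simp flip: mult.assoc)
  also have "\<dots> = (if \<not> p then gen j * x * gen i else - (gen j * x * gen i))"
    using gen_mult by (simp add: mult.assoc)
  finally show ?case .
qed (auto simp: algebra_simps)

text \<open>
  An ideal without nonzero scalars contains no nonzero even element. Write \<open>x = a + e\<^sub>i b\<close>. Then
  \<open>x - e\<^sub>i x e\<^sub>i = 2 a\<close> lies in the ideal, so \<open>a = 0\<close> by induction, and \<open>b = - e\<^sub>i x\<close> lies in it
  as well. As \<open>b\<close> is odd, induction applies to \<open>e\<^sub>j b\<close> for some \<open>j \<in> S\<close>; if \<open>S\<close> is empty, the only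
  odd element is \<open>0\<close>.
\<close>

lemma even_kernel_trivial:
  fixes J :: "'n::finite cclifford set"
  assumes "finite S"
    and ideal: "two_sided_ideal J" "\<And>c. cx_scalar c \<in> J \<Longrightarrow> c = 0"
    and "graded S True x" "x \<in> J"
  shows "x = 0"
proof -
  have mult: "a * y * b \<in> J" if "y \<in> J" for a b y
    using ideal(1) that by (simp add: two_sided_ideal_def)
  have left: "a * y \<in> J" if "y \<in> J" for a y
    using mult[OF that, of a 1] by simp
  have add: "y + z \<in> J" if "y \<in> J" "z \<in> J" for y z
    using ideal(1) that by (simp add: two_sided_ideal_def)
  have graded_empty: "(p \<longrightarrow> y \<in> range cx_scalar) \<and> (\<not> p \<longrightarrow> y = 0)" if "graded {} p y"
    for p and y :: "'n cclifford"
    using that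
  proof induction
    case (zero p)
    show ?case using range_eqI[of "0 :: 'n cclifford" cx_scalar 0] by simp
  next
    case (add p x y)
    have "cx_scalar c + cx_scalar d \<in> range (cx_scalar :: complex \<Rightarrow> 'n cclifford)" for c d
      by (metis cx_scalar_hom(5) rangeI)
    then show ?case using add.IH by auto
  qed simp_all
  show ?thesis
    using assms(1,4,5)
  proof (induction S arbitrary: x rule: finite_induct)
    case empty
    then show ?case using graded_empty[of True x] ideal(2) by fastforce
  next
    case (insert i S)
    obtain a b where ab: "graded S True a" "graded S False b" "x = a + gen i * b"
      using graded_insert_decompose[OF insert.prems(1)] by auto
    have comm: "gen i * a = a * gen i" "gen i * b = - (b * gen i)"
      using graded_commute_gen[OF ab(1) insert.hyps(2)] graded_commute_gen[OF ab(2) insert.hyps(2)]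
      by simp_all
    have "gen i * (a * gen i) = - a"
      unfolding comm(1)[symmetric] by (simp add: gen_square flip: mult.assoc)
    moreover have "gen i * b * gen i = b"
    proof -
      have "b * gen i = - (gen i * b)"
        using comm(2) by simp
      then have "gen i * b * gen i = - (gen i * gen i * b)"
        by (simp add: mult.assoc)
      then show ?thesis by (simp add: gen_square)
    qed
    ultimately have "x + - 1 * (gen i * x * gen i) = 2 *\<^sub>R a"
      by (simp add: ab(3) distrib_left distrib_right scaleR_2) (simp add: mult.assoc)
    moreover have "x + - 1 * (gen i * x * gen i) \<in> J"
      by (intro add left mult insert.prems(2))
    ultimately have "((1/2) *\<^sub>R 1) * (2 *\<^sub>R a) \<in> J"
      using left by metis
    then have "a = 0"
      using insert.IH[OF ab(1)] by simp
    moreover have "b = 0"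
    proof (cases "S = {}")
      case True
      then show ?thesis using graded_empty[of False b] ab(2) by simp
    next
      case False
      then obtain j where j: "j \<in> S" by blast
      have "b = - (gen i * x)"
        using ab(3) \<open>a = 0\<close> by (simp add: gen_square flip: mult.assoc)
      then have "gen j * b \<in> J"
        using left[OF insert.prems(2), of "- (gen j * gen i)"] by (simp add: mult.assoc)
      moreover have "graded S True (gen j * b)"
        using graded.gen_mult[OF j ab(2)] by simp
      ultimately have "gen j * b = 0" using insert.IH by simp
      then have "gen j * gen j * b = 0" by (simp add: mult.assoc)
      then show ?thesis by (simp add: gen_square)
    qed
    ultimately show ?case by (simp add: ab(3))
  qed
qed

section \<open>Representations of the complexified Clifford algebra\<close>

lemma complex_algebra_rep_hom:
  assumes "complex_algebra_rep \<rho>"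
  shows "\<rho> (x + y) = \<rho> x + \<rho> y"
    and "\<rho> (x * y) = \<rho> x ** \<rho> y"
    and "\<rho> (cx_scalar c) = mat c"
    and "\<rho> 1 = mat 1"
    and "\<rho> 0 = 0"
    and "\<rho> (r *\<^sub>R x) = r *\<^sub>R \<rho> x"
proof -
  show add: "\<rho> (x + y) = \<rho> x + \<rho> y" and mult: "\<rho> (x * y) = \<rho> x ** \<rho> y"
    and scalar: "\<rho> (cx_scalar c) = mat c" for x y c
    using assms by (simp_all add: complex_algebra_rep_def)
  show "\<rho> 1 = mat 1" using scalar[of 1] by simp
  show "\<rho> 0 = 0" using add[of 0 0] by simp
  have "\<rho> (r *\<^sub>R x) = \<rho> (cx_scalar (of_real r) * x)"
    by (simp add: scaleR_conv_of_real)
  also have "\<dots> = r *\<^sub>R \<rho> x"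
    unfolding mult scalar mat_mult_left
    by (simp add: vec_eq_iff scaleR_conv_of_real[where 'a = complex])
  finally show "\<rho> (r *\<^sub>R x) = r *\<^sub>R \<rho> x" .
qed

lemma linear_complex_algebra_rep: "complex_algebra_rep \<rho> \<Longrightarrow> linear \<rho>"
  by (rule linearI) (simp_all add: complex_algebra_rep_hom)

text \<open>
  The kernel is a two-sided ideal, and it contains no nonzero scalar because \<open>\<rho>\<close> maps \<open>c\<close> to the
  scalar matrix \<open>c\<close>. The restriction to the even part matters in odd dimensions, where the whole
  complex algebra is a product of two matrix algebras and an irreducible \<open>\<rho>\<close> kills one of them.
\<close>

lemma rep_injective_on_even:
  fixes \<rho> :: "'n::finite cclifford \<Rightarrow> complex ^ 'k ^ 'k"
  assumes "complex_algebra_rep \<rho>"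
  shows "inj_on \<rho> {x. graded UNIV True x}"
  unfolding linear_inj_on_iff_eq_0[OF linear_complex_algebra_rep[OF assms] subspace_graded]
proof (intro ballI impI)
  fix x
  assume x: "x \<in> {x. graded UNIV True x}" "\<rho> x = 0"
  show "x = 0"
  proof (rule even_kernel_trivial)
    show "two_sided_ideal {x. \<rho> x = 0}"
      by (simp add: two_sided_ideal_def complex_algebra_rep_hom[OF assms])
    show "c = 0" if "cx_scalar c \<in> {x. \<rho> x = 0}" for c
    proof -
      have "mat c = (0 :: complex ^ 'k ^ 'k)"
        using that by (simp add: complex_algebra_rep_hom[OF assms])
      then have "mat c $ i $ i = (0 :: complex ^ 'k ^ 'k) $ i $ i" for i
        by simp
      then show ?thesis by (simp add: mat_def)
    qed
  qed (use x in auto)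
qed

text \<open>
  An eigenspace of \<open>M\<close> is invariant under \<open>\<rho>\<close> and nonzero, hence everything.
\<close>

lemma schur:
  fixes \<rho> :: "'a::real_algebra_1 complexified \<Rightarrow> complex ^ 'k ^ 'k"
  assumes irred: "irreducible_rep \<rho>" and comm: "\<And>x. M ** \<rho> x = \<rho> x ** M"
  obtains c where "M = mat c"
proof -
  obtain c v where v: "v \<noteq> 0" "M *v v = c *s v"
    by (rule complex_matrix_eigenvalue)
  let ?W = "{w. M *v w = c *s w}"
  have "vec.subspace ?W"
    by (simp add: vec.subspace_def matrix_vector_right_distrib vector_add_ldistrib
        vec.scale vector_smult_assoc mult.commute)
  moreover have "\<rho> x *v w \<in> ?W" if "w \<in> ?W" for x w
  proof -
    have "M *v (\<rho> x *v w) = \<rho> x *v (M *v w)"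
      by (simp add: matrix_vector_mul_assoc comm)
    then show ?thesis using that by (simp add: vec.scale)
  qed
  ultimately have "?W = {0} \<or> ?W = UNIV"
    using irred unfolding irreducible_rep_def by blast
  then have "?W = UNIV" using v by blast
  then have "M *v w = mat c *v w" for w
    by (auto simp: vec_eq_iff matrix_vector_mult_def mat_def if_distrib[of "\<lambda>x. x * _"] cong: if_cong)
  then have "M = mat c" by (simp add: matrix_eq)
  then show thesis by (rule that)
qed

section \<open>The group of even products with complex scalars\<close>

text \<open>
  The class \<open>[A, c]\<close>, that is, the coset of \<open>(A, c)\<close> modulo \<open>{(1, 1), (-1, -1)}\<close>.
\<close>

definition spinc :: "'n::finite clifford \<Rightarrow> complex \<Rightarrow> ('n clifford \<times> complex) set" where
  "spinc A c = {(A, c), (- A, - c)}"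

lemma SpinC_mult: "spinc A c \<otimes>\<^bsub>SpinC_group\<^esub> spinc B d = spinc (A * B) (c * d)"
  by (auto simp: spinc_def SpinC_group_def FactGroup_def set_mult_def DirProd_def Spin_group_def
      unit_group_def)

lemma mem_Spin_group:
  "A \<in> carrier Spin_group \<longleftrightarrow>
     (\<exists>vs. A = clifford_prod vs \<and> even (length vs) \<and> (\<forall>v\<in>set vs. norm v = 1))"
  by (auto simp: Spin_group_def clifford_prod_def)

lemma mem_SpinC_group:
  fixes X :: "('n::finite clifford \<times> complex) set"
  shows "X \<in> carrier SpinC_group \<longleftrightarrow> (\<exists>A\<in>carrier Spin_group. \<exists>c. c \<noteq> 0 \<and> X = spinc A c)"
proof -
  have coset: "spinc_kernel #>\<^bsub>Spin_group \<times>\<times> unit_group\<^esub> (A, c) = spinc A c"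
    for A :: "'n clifford" and c
    by (auto simp: r_coset_def spinc_kernel_def spinc_def DirProd_def Spin_group_def unit_group_def)
  have "carrier (unit_group :: complex monoid) = {c. c \<noteq> 0}"
    by (auto simp: unit_group_def intro: exI[of _ "1 / _"])
  then have "carrier ((Spin_group :: 'n clifford monoid) \<times>\<times> (unit_group :: complex monoid))
      = carrier Spin_group \<times> {c. c \<noteq> 0}"
    by (simp add: DirProd_def)
  then show ?thesis
    by (auto simp: SpinC_group_def FactGroup_def RCOSETS_def coset)
qed

lemma SpinC_cases:
  assumes "X \<in> carrier SpinC_group"
  obtains vs c where "X = spinc (clifford_prod vs) c" "even (length vs)" "\<forall>v\<in>set vs. norm v = 1" "c \<noteq> 0"
proof -
  obtain A c where "A \<in> carrier Spin_group" "c \<noteq> 0" "X = spinc A c"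
    using assms unfolding mem_SpinC_group by blast
  then show thesis
    using that unfolding mem_Spin_group by blast
qed

lemma spinc_mem:
  assumes "even (length vs)" "\<forall>v\<in>set vs. norm v = 1" "c \<noteq> 0"
  shows "spinc (clifford_prod vs) c \<in> carrier SpinC_group"
proof -
  have "clifford_prod vs \<in> carrier Spin_group"
    using assms(1,2) unfolding mem_Spin_group by blast
  then show ?thesis
    using assms(3) unfolding mem_SpinC_group by blast
qed

lemma spinc_incl_spinc: "spinc_incl (spinc A c) = cx_scalar c * complexify A"
  by (simp add: spinc_incl_def spinc_def)

lemma spinc_incl_inverse:
  assumes "even (length vs)" "\<forall>v\<in>set vs. norm v = 1" "c \<noteq> 0"
  defines "x \<equiv> cx_scalar c * complexify (clifford_prod vs)"
  defines "y \<equiv> cx_scalar (1 / c) * complexify (clifford_prod (rev vs))"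
  shows "x * y = 1" "y * x = 1"
  unfolding x_def y_def cx_scalar_mult_mult complexify_hom(5)[symmetric]
  by (use assms(1-3) in \<open>simp_all add: clifford_prod_inverse del: complexify_hom(5)\<close>)

lemma unit_group_inv:
  assumes "x * y = 1" "y * x = 1"
  shows "inv\<^bsub>unit_group\<^esub> x = y"
  unfolding m_inv_def
proof (rule the_equality)
  show "y \<in> carrier unit_group \<and> x \<otimes>\<^bsub>unit_group\<^esub> y = \<one>\<^bsub>unit_group\<^esub> \<and> y \<otimes>\<^bsub>unit_group\<^esub> x = \<one>\<^bsub>unit_group\<^esub>"
    using assms by (auto simp: unit_group_def)
  show "z = y" if "z \<in> carrier unit_group \<and> x \<otimes>\<^bsub>unit_group\<^esub> z = \<one>\<^bsub>unit_group\<^esub> \<and> z \<otimes>\<^bsub>unit_group\<^esub> x = \<one>\<^bsub>unit_group\<^esub>" for z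
  proof -
    have "z = (y * x) * z" using assms by simp
    also have "\<dots> = y" using that by (simp add: unit_group_def mult.assoc)
    finally show ?thesis .
  qed
qed

text \<open>
  The scalar \<open>c\<close> is central, so it has no effect on conjugation.
\<close>

lemma spinc_conj:
  assumes "even (length vs)" "\<forall>v\<in>set vs. norm v = 1" "c \<noteq> 0"
  defines "x \<equiv> spinc_incl (spinc (clifford_prod vs) c)"
  shows "x * y * inv\<^bsub>unit_group\<^esub> x = complexify (clifford_prod vs) * y * complexify (clifford_prod (rev vs))"
proof -
  have "x * y * inv\<^bsub>unit_group\<^esub> x = cx_scalar c * (complexify (clifford_prod vs) * y) *
      (cx_scalar (1 / c) * complexify (clifford_prod (rev vs)))"
    using unit_group_inv[OF spinc_incl_inverse[OF assms(1-3)]]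
    by (simp add: x_def spinc_incl_spinc mult.assoc)
  also have "\<dots> = cx_scalar (c * (1 / c)) * (complexify (clifford_prod vs) * y * complexify (clifford_prod (rev vs)))"
    by (simp only: cx_scalar_mult_mult)
  finally show ?thesis using assms(3) by simp
qed

text \<open>
  The description in the definition of \<open>Ad\<close> determines a unique matrix, since vectors embed
  injectively into the Clifford algebra.
\<close>

lemma Ad_spinc:
  assumes "even (length vs)" "\<forall>v\<in>set vs. norm v = 1" "c \<noteq> 0"
  shows "Ad (spinc (clifford_prod vs) c) = reflections vs"
proof -
  have "(\<forall>y. cclifford_vec (B *v y) = complexify (clifford_prod vs) * cclifford_vec y * complexify (clifford_prod (rev vs)))
      \<longleftrightarrow> B = reflections vs" for B
    by (simp add: cclifford_vec_def clifford_prod_conj[OF assms(2)] inj_eq[OF inj_clifford_vec] matrix_eq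
        flip: complexify_hom)
  then show ?thesis
    by (simp add: Ad_def spinc_conj[OF assms])
qed

lemma SpinC_mult_closed:
  assumes "X \<in> carrier SpinC_group" "Y \<in> carrier SpinC_group"
  shows "X \<otimes>\<^bsub>SpinC_group\<^esub> Y \<in> carrier SpinC_group"
    and "Ad (X \<otimes>\<^bsub>SpinC_group\<^esub> Y) = Ad X ** Ad Y"
    and "spinc_incl (X \<otimes>\<^bsub>SpinC_group\<^esub> Y) = spinc_incl X * spinc_incl Y"
proof -
  obtain vs c where X: "X = spinc (clifford_prod vs) c"
    and vs: "even (length vs)" "\<forall>v\<in>set vs. norm v = 1" "c \<noteq> 0"
    using assms(1) by (rule SpinC_cases)
  obtain ws d where Y: "Y = spinc (clifford_prod ws) d"
    and ws: "even (length ws)" "\<forall>v\<in>set ws. norm v = 1" "d \<noteq> 0"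
    using assms(2) by (rule SpinC_cases)
  have XY: "X \<otimes>\<^bsub>SpinC_group\<^esub> Y = spinc (clifford_prod (vs @ ws)) (c * d)"
    by (simp add: X Y SpinC_mult)
  have vws: "even (length (vs @ ws))" "\<forall>v\<in>set (vs @ ws). norm v = 1" "c * d \<noteq> 0"
    using vs ws by auto
  show "X \<otimes>\<^bsub>SpinC_group\<^esub> Y \<in> carrier SpinC_group"
    unfolding XY by (rule spinc_mem[OF vws])
  show "Ad (X \<otimes>\<^bsub>SpinC_group\<^esub> Y) = Ad X ** Ad Y"
    unfolding XY Ad_spinc[OF vws] by (simp add: X Y Ad_spinc vs ws reflections_append)
  show "spinc_incl (X \<otimes>\<^bsub>SpinC_group\<^esub> Y) = spinc_incl X * spinc_incl Y"
    by (simp only: X Y SpinC_mult spinc_incl_spinc cx_scalar_mult_mult complexify_hom(5))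
qed

lemma Ad_hom: "Ad \<in> hom (SpinC_group :: ('n::finite clifford \<times> complex) set monoid) SO_group"
proof (rule homI)
  fix X :: "('n clifford \<times> complex) set"
  assume "X \<in> carrier SpinC_group"
  then obtain vs c where X: "X = spinc (clifford_prod vs) c"
    and vs: "even (length vs)" "\<forall>v\<in>set vs. norm v = 1" "c \<noteq> 0"
    by (rule SpinC_cases)
  then show "Ad X \<in> carrier SO_group"
    by (simp add: SO_group_def Ad_spinc rotation_matrix_def orthogonal_reflections det_reflections)
qed (simp add: SpinC_mult_closed SO_group_def)

lemma spinc_incl_unit:
  assumes "X \<in> carrier SpinC_group"
  obtains y where "spinc_incl X * y = 1" "y * spinc_incl X = 1"
  using assms spinc_incl_inverse by (metis SpinC_cases spinc_incl_spinc)

lemma spinc_rep_hom: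
  fixes \<rho> :: "'n::finite cclifford \<Rightarrow> complex ^ 'k ^ 'k"
  assumes "complex_algebra_rep \<rho>"
  shows "spinc_rep \<rho> \<in> hom SpinC_group GL_group"
proof (rule homI)
  fix X :: "('n clifford \<times> complex) set"
  assume "X \<in> carrier SpinC_group"
  then obtain y where "spinc_incl X * y = 1" "y * spinc_incl X = 1"
    by (rule spinc_incl_unit)
  then have "\<rho> (spinc_incl X) ** \<rho> y = mat 1" "\<rho> y ** \<rho> (spinc_incl X) = mat 1"
    by (metis complex_algebra_rep_hom(2,4)[OF assms])+
  then show "spinc_rep \<rho> X \<in> carrier GL_group"
    by (auto simp: GL_group_def spinc_rep_def invertible_def)
qed (simp add: SpinC_mult_closed GL_group_def spinc_rep_def complex_algebra_rep_hom[OF assms])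

lemma rep_Ad:
  assumes rep: "complex_algebra_rep \<rho>" and "X \<in> carrier SpinC_group"
  shows "\<rho> (cclifford_map (Ad X) y) = spinc_rep \<rho> X ** \<rho> y ** matrix_inv (spinc_rep \<rho> X)"
proof -
  obtain vs c where X: "X = spinc (clifford_prod vs) c"
    and vs: "even (length vs)" "\<forall>v\<in>set vs. norm v = 1" "c \<noteq> 0"
    using assms(2) by (rule SpinC_cases)
  obtain z where z: "spinc_incl X * z = 1" "z * spinc_incl X = 1"
    using assms(2) by (rule spinc_incl_unit)
  then have "matrix_inv (spinc_rep \<rho> X) = \<rho> z"
    unfolding spinc_rep_def
    by (intro matrix_inv_eqI) (metis complex_algebra_rep_hom(2,4)[OF rep])
  moreover have "cclifford_map (Ad X) y = spinc_incl X * y * z"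
    using spinc_conj[OF vs, of y] z unit_group_inv[of "spinc_incl X" z]
    by (simp add: X Ad_spinc[OF vs] cclifford_map_reflections vs)
  ultimately show ?thesis
    by (simp add: complex_algebra_rep_hom[OF rep] spinc_rep_def)
qed

lemma graded_spinc_incl:
  assumes "X \<in> carrier SpinC_group"
  shows "graded UNIV True (spinc_incl X)"
proof -
  obtain vs c where "X = spinc (clifford_prod vs) c" "even (length vs)"
    using assms by (rule SpinC_cases)
  then show ?thesis
    using graded_scalar_mult[OF graded_clifford_prod[of vs], of c] by (simp add: spinc_incl_spinc)
qed

text \<open>
  A real scalar that is a product of unit vectors is \<open>\<plusminus>1\<close>, and determinants of representing
  matrices detect this: \<open>\<rho>(v)\<^sup>2 = -1\<close> makes \<open>det \<rho>(v)\<close> a number of modulus one for every unit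
  vector \<open>v\<close>. Then \<open>r\<^sup>k\<close>, the determinant of the scalar matrix \<open>r\<close> of size \<open>k\<close>, has modulus one as
  well.
\<close>

lemma scalar_clifford_prod:
  fixes \<rho> :: "'n::finite cclifford \<Rightarrow> complex ^ 'k ^ 'k" and vs :: "(real ^ 'n) list"
  assumes rep: "complex_algebra_rep \<rho>"
    and vs: "\<forall>v\<in>set vs. norm v = 1" and scalar: "clifford_prod vs = of_real r"
  shows "\<bar>r\<bar> = 1"
proof -
  have det_vec: "norm (det (\<rho> (cclifford_vec v))) = 1" if "norm v = 1" for v
  proof -
    have "v \<bullet> v = 1" using that by (simp add: norm_eq_1)
    then have "cclifford_vec v * cclifford_vec v = cx_scalar (- 1)"
      by (simp add: cclifford_vec_def clifford_vec_square flip: complexify_hom)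
    then have "\<rho> (cclifford_vec v) ** \<rho> (cclifford_vec v) = mat (- 1)"
      by (metis complex_algebra_rep_hom(2,3)[OF rep])
    then have "det (\<rho> (cclifford_vec v)) ^ 2 = det (mat (- 1) :: complex ^ 'k ^ 'k)"
      by (metis det_mul power2_eq_square)
    also have "\<dots> = (- 1) ^ CARD('k)"
      by (subst det_diagonal) (auto simp: mat_def)
    finally have "norm (det (\<rho> (cclifford_vec v))) ^ 2 = 1"
      by (metis norm_minus_cancel norm_one norm_power power_one)
    then show ?thesis
      using norm_ge_zero[of "det (\<rho> (cclifford_vec v))"] by (auto simp: power2_eq_1_iff)
  qed
  have "norm (det (\<rho> (complexify (clifford_prod vs)))) = 1"
    using vs
  proof (induction vs)
    case (Cons v vs)
    then show ?case
      using det_vec[of v]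
      by (simp add: complex_algebra_rep_hom[OF rep] det_mul norm_mult flip: cclifford_vec_def)
  qed (simp add: complex_algebra_rep_hom[OF rep])
  moreover have "complexify (of_real r) = (cx_scalar (of_real r) :: 'n cclifford)"
    by (simp only: cx_scalar_hom(4)) (simp add: of_real_def)
  then have "\<rho> (complexify (clifford_prod vs)) = mat (of_real r)"
    unfolding scalar by (metis complex_algebra_rep_hom(3)[OF rep])
  moreover have "det (mat (of_real r) :: complex ^ 'k ^ 'k) = of_real r ^ CARD('k)"
    by (subst det_diagonal) (auto simp: mat_def)
  ultimately have "\<bar>r\<bar> ^ CARD('k) = 1"
    by (simp add: norm_power)
  then show ?thesis
    using power_eq_1_iff[of "\<bar>r\<bar>" "CARD('k)"] by (simp add: power_eq_iff_eq_base)
qed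

text \<open>
  If \<open>c A = d B\<close> with products \<open>A\<close>, \<open>B\<close> of unit vectors, then \<open>A B\<inverse>\<close> is the scalar \<open>d / c\<close>. This
  scalar is real because \<open>A B\<inverse>\<close> is, and it is \<open>\<plusminus>1\<close> by \<open>scalar_clifford_prod\<close>. So \<open>(A, c)\<close> and \<open>(B,
  d)\<close> differ by an element of the kernel.
\<close>

lemma spinc_incl_injective:
  fixes \<rho> :: "'n::finite cclifford \<Rightarrow> complex ^ 'k ^ 'k"
  assumes rep: "complex_algebra_rep \<rho>"
  shows "inj_on spinc_incl (carrier (SpinC_group :: ('n clifford \<times> complex) set monoid))"
proof (rule inj_onI)
  fix X Y :: "('n clifford \<times> complex) set"
  assume XY: "X \<in> carrier SpinC_group" "Y \<in> carrier SpinC_group" "spinc_incl X = spinc_incl Y"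
  obtain vs c where X: "X = spinc (clifford_prod vs) c"
    and vs: "even (length vs)" "\<forall>v\<in>set vs. norm v = 1" "c \<noteq> 0"
    using XY(1) by (rule SpinC_cases)
  obtain ws d where Y: "Y = spinc (clifford_prod ws) d"
    and ws: "even (length ws)" "\<forall>v\<in>set ws. norm v = 1" "d \<noteq> 0"
    using XY(2) by (rule SpinC_cases)
  let ?A = "clifford_prod (vs @ rev ws)"
  have "cx_scalar (1 / c) * (cx_scalar c * complexify (clifford_prod vs)) * complexify (clifford_prod (rev ws))
     = cx_scalar (1 / c) * (cx_scalar d * complexify (clifford_prod ws)) * complexify (clifford_prod (rev ws))"
    using XY(3) by (simp add: X Y spinc_incl_spinc)
  then have "cx_scalar (1 / c * c) * complexify ?A = cx_scalar (1 / c * d) * complexify (clifford_prod ws * clifford_prod (rev ws))"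
    by (simp only: cx_scalar_hom(6) complexify_hom(5) clifford_prod_simps(3) mult.assoc)
  then have A: "complexify ?A = cx_scalar (d / c)"
    using vs(3) by (simp add: clifford_prod_inverse ws)
  then have Im: "Im (d / c) = 0" and Re: "?A = of_real (Re (d / c))"
    by (simp_all add: complexify_def cx_scalar_def)
  have "\<bar>Re (d / c)\<bar> = 1"
    by (rule scalar_clifford_prod[OF rep _ Re]) (use vs ws in auto)
  then have "d / c = 1 \<or> d / c = - 1"
    using Im by (auto simp: complex_eq_iff abs_eq_iff')
  then have dc: "d = c \<and> ?A = 1 \<or> d = - c \<and> ?A = - 1"
    using vs(3) Re by (auto simp: divide_eq_eq)
  have "clifford_prod vs = ?A * clifford_prod ws"
    by (simp add: mult.assoc clifford_prod_inverse ws)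
  then show "X = Y"
    using dc by (auto simp: X Y spinc_def)
qed

lemma spinc_rep_injective:
  fixes \<rho> :: "'n::finite cclifford \<Rightarrow> complex ^ 'k ^ 'k"
  assumes rep: "complex_algebra_rep \<rho>"
  shows "inj_on (spinc_rep \<rho>) (carrier SpinC_group)"
proof (rule inj_onI)
  fix X Y :: "('n clifford \<times> complex) set"
  assume XY: "X \<in> carrier SpinC_group" "Y \<in> carrier SpinC_group" "spinc_rep \<rho> X = spinc_rep \<rho> Y"
  have "spinc_incl X = spinc_incl Y"
    using XY(3) unfolding spinc_rep_def
    by (rule inj_onD[OF rep_injective_on_even[OF rep]]) (simp_all add: graded_spinc_incl XY(1,2))
  then show "X = Y"
    by (rule inj_onD[OF spinc_incl_injective[OF rep]]) (simp_all add: XY(1,2))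
qed

section \<open>Lifting intertwining pairs\<close>

text \<open>
  Here \<open>x\<close> is an even product of unit vectors over \<open>B\<close>, with inverse \<open>x'\<close>. Both \<open>E\<close> and \<open>\<rho> x\<close>
  intertwine \<open>\<rho>\<close> with its twist by \<open>B\<close>, so they differ by a scalar.
\<close>

lemma SpinC_lift:
  fixes \<rho> :: "'n::finite cclifford \<Rightarrow> complex ^ 'k ^ 'k"
  assumes irred: "irreducible_rep \<rho>" and B: "rotation_matrix B" and E: "invertible E"
    and conj: "\<And>y. \<rho> (cclifford_map B y) = E ** \<rho> y ** matrix_inv E"
  obtains X where "X \<in> carrier SpinC_group" "Ad X = B" "spinc_rep \<rho> X = E"
proof -
  have rep: "complex_algebra_rep \<rho>"
    using irred by (simp add: irreducible_rep_def)
  note hom = complex_algebra_rep_hom[OF rep]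
  obtain vs where vs: "\<forall>v\<in>set vs. norm v = 1" "B = reflections vs"
    using B orthogonal_matrix_product_of_reflections by (metis rotation_matrix_def)
  have even: "even (length vs)"
    using B det_reflections[OF vs(1)] by (auto simp: vs(2) rotation_matrix_def minus_one_power_iff split: if_splits)
  define x where "x = complexify (clifford_prod vs)"
  define x' where "x' = complexify (clifford_prod (rev vs))"
  have "x * x' = 1" "x' * x = 1"
    by (simp_all add: x_def x'_def clifford_prod_inverse even vs(1) flip: complexify_hom(5))
  then have xx': "\<rho> x ** \<rho> x' = mat 1" "\<rho> x' ** \<rho> x = mat 1"
    by (metis hom(2,4))+
  have Einv: "matrix_inv E ** E = mat 1"
    by (rule matrix_inv_left[OF E])
  have "(\<rho> x' ** E) ** \<rho> y = \<rho> y ** (\<rho> x' ** E)" for y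
  proof -
    have "\<rho> x ** \<rho> y ** \<rho> x' = E ** \<rho> y ** matrix_inv E"
      using conj[of y] by (simp add: vs cclifford_map_reflections even x_def x'_def hom)
    then have "\<rho> x' ** (\<rho> x ** \<rho> y ** \<rho> x') ** E = \<rho> x' ** (E ** \<rho> y ** matrix_inv E) ** E"
      by simp
    then have "(\<rho> x' ** \<rho> x) ** \<rho> y ** \<rho> x' ** E = \<rho> x' ** E ** \<rho> y ** (matrix_inv E ** E)"
      by (simp only: matrix_mul_assoc)
    then show ?thesis by (simp add: xx' Einv matrix_mul_assoc)
  qed
  then obtain c where c: "\<rho> x' ** E = mat c"
    using schur[OF irred] by blast
  have "E = \<rho> x ** (\<rho> x' ** E)"
    by (simp add: matrix_mul_assoc xx')
  then have E_eq: "E = \<rho> (cx_scalar c * x)"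
    by (simp add: c hom mat_mult_left mat_mult_right)
  have "c \<noteq> 0"
  proof
    assume "c = 0"
    then have "E = 0" using E_eq hom(5) by simp
    then have "(mat 1 :: complex ^ 'k ^ 'k) = 0"
      using Einv by (simp add: vec_eq_iff matrix_matrix_mult_def)
    then have "(mat 1 :: complex ^ 'k ^ 'k) $ i $ i = 0" for i
      by simp
    then show False by (simp add: mat_def)
  qed
  then show thesis
    using that[of "spinc (clifford_prod vs) c"] vs even
    by (simp add: spinc_mem Ad_spinc spinc_rep_def spinc_incl_spinc E_eq x_def)
qed

section \<open>Smoothness of the lift\<close>

text \<open>
  The partial derivatives in \<open>Ck_on\<close> are taken along full coordinate lines, which leave \<open>S\<close>. So
  \<open>f\<close> may be replaced by a function that agrees with it only on \<open>S\<close> because \<open>S\<close> is open: near \<open>x \<in>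
  S\<close> the coordinate lines stay in \<open>S\<close>.
\<close>

lemma Ck_on_cong:
  assumes S: "openin (Euclidean_space d) S" and eq: "\<And>x. x \<in> S \<Longrightarrow> f x = g x"
    and f: "Ck_on d k S f"
  shows "Ck_on d k S g"
proof -
  have "continuous_map (subtopology (Euclidean_space d) S) euclideanreal f"
    using f by (cases k) simp_all
  then have cont: "continuous_map (subtopology (Euclidean_space d) S) euclideanreal g"
    by (rule continuous_map_eq) (simp add: eq)
  show ?thesis
  proof (cases k)
    case (Suc l)
    have "((\<lambda>t. g (x(i := t))) has_real_derivative D) (at (x i))"
      if x: "x \<in> S" and i: "i < d" and D: "((\<lambda>t. f (x(i := t))) has_real_derivative D) (at (x i))"
      for x i D
    proof -
      have "x \<in> topspace (Euclidean_space d)"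
        using openin_subset[OF S] x by blast
      then have zero: "x j = 0" if "j \<ge> d" for j
        using that by (auto simp: topspace_Euclidean_space)
      have "continuous_map euclideanreal (Euclidean_space d) (\<lambda>t. x(i := t))"
        unfolding Euclidean_space_def continuous_map_in_subtopology continuous_map_componentwise_UNIV
        using i zero by (auto simp: fun_upd_def)
      then have "openin euclideanreal {t \<in> topspace euclideanreal. x(i := t) \<in> S}"
        using S by (rule openin_continuous_map_preimage)
      then have "open {t. x(i := t) \<in> S}"
        by simp
      moreover have "x i \<in> {t. x(i := t) \<in> S}"
        using x by simp
      ultimately show ?thesis
        using D eq has_field_derivative_transform_within_open by fastforce
    qed
    then show ?thesis using f cont unfolding Suc by fastforce
  qed (simp add: cont)
qed

lemma smooth_coord_cong:
  assumes "openin (Euclidean_space d) S" "\<And>x. x \<in> S \<Longrightarrow> f x = g x" "smooth_coord d S f"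
  shows "smooth_coord d S g"
  using assms Ck_on_cong unfolding smooth_coord_def by blast

text \<open>
  On the even part \<open>\<rho>\<close> has a linear left inverse \<open>L\<close>. Testing \<open>f\<close> with a functional \<open>l\<close> amounts to
  testing \<open>\<epsilon>\<close> with the functional \<open>l \<circ> L\<close>.
\<close>

lemma smooth_spinc_incl:
  fixes \<rho> :: "'n::finite cclifford \<Rightarrow> complex ^ 'k ^ 'k"
  assumes rep: "complex_algebra_rep \<rho>"
    and M: "smooth_manifold M" and carrier: "\<And>A. A \<in> topspace (man_top M) \<Longrightarrow> f A \<in> carrier SpinC_group"
    and eps: "\<And>A. A \<in> topspace (man_top M) \<Longrightarrow> \<epsilon> A = spinc_rep \<rho> (f A)"
    and smooth: "smooth_into_vector_space M \<epsilon>"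
  shows "smooth_into_vector_space M (\<lambda>A. spinc_incl (f A))"
proof -
  obtain L where L: "linear L" "\<And>x. graded UNIV True x \<Longrightarrow> L (\<rho> x) = x"
    using linear_exists_left_inverse_on[OF linear_complex_algebra_rep[OF rep] subspace_graded
        rep_injective_on_even[OF rep]] by auto
  show ?thesis
    unfolding smooth_into_vector_space_def
  proof (intro allI impI ballI, clarify)
    fix l :: "'n cclifford \<Rightarrow> real" and U \<phi>
    assume l: "linear l" and U: "(U, \<phi>) \<in> man_atlas M"
    have "linear (\<lambda>x. l (L x))"
      using linear_compose[OF L(1) l] by (simp add: o_def)
    then have "smooth_coord (man_dim M) (\<phi> ` U) (\<lambda>z. l (L (\<epsilon> (inv_into U \<phi> z))))"
      using smooth U unfolding smooth_into_vector_space_def by blast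
    moreover have atlas: "\<forall>(U, \<phi>)\<in>man_atlas M.
        openin (man_top M) U \<and> openin (Euclidean_space (man_dim M)) (\<phi> ` U) \<and>
        homeomorphic_map (subtopology (man_top M) U)
          (subtopology (Euclidean_space (man_dim M)) (\<phi> ` U)) \<phi>"
      using M unfolding smooth_manifold_def by (elim conjE)
    have "openin (Euclidean_space (man_dim M)) (\<phi> ` U)"
      using bspec[OF atlas U] by simp
    moreover have "l (L (\<epsilon> (inv_into U \<phi> z))) = l (spinc_incl (f (inv_into U \<phi> z)))" if "z \<in> \<phi> ` U" for z
    proof -
      have "openin (man_top M) U"
        using bspec[OF atlas U] by simp
      then have "inv_into U \<phi> z \<in> topspace (man_top M)"
        using inv_into_into[OF that] openin_subset by blast
      then show ?thesis
        by (simp add: eps spinc_rep_def L(2) graded_spinc_incl carrier)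
    qed
    ultimately show "smooth_coord (man_dim M) (\<phi> ` U) (\<lambda>z. l (spinc_incl (f (inv_into U \<phi> z))))"
      by (rule smooth_coord_cong[rotated 2])
  qed
qed

section \<open>The universal property\<close>

theorem theorem4p1:
  fixes \<rho> :: "'n::finite cclifford \<Rightarrow> complex ^ 'k ^ 'k"
  assumes "CARD('k) = 2 ^ (CARD('n) div 2)"
    and "irreducible_rep \<rho>"
  shows
    "(Ad \<in> hom (SpinC_group :: ('n clifford \<times> complex) set monoid) SO_group \<and>
      spinc_rep \<rho> \<in> hom SpinC_group GL_group \<and>
      (\<forall>A\<in>carrier SpinC_group. \<forall>y.
         \<rho> (cclifford_map (Ad A) y) = spinc_rep \<rho> A ** \<rho> y ** matrix_inv (spinc_rep \<rho> A))) \<and>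
     (\<forall>(G' :: 'g monoid) M p' \<epsilon>'.
        lie_group G' M \<and> p' \<in> hom G' SO_group \<and> \<epsilon>' \<in> hom G' GL_group \<and>
        (\<forall>A\<in>carrier G'. \<forall>y.
           \<rho> (cclifford_map (p' A) y) = \<epsilon>' A ** \<rho> y ** matrix_inv (\<epsilon>' A)) \<longrightarrow>
        (\<exists>f\<in>hom G' SpinC_group.
           (\<forall>A\<in>carrier G'. p' A = Ad (f A) \<and> \<epsilon>' A = spinc_rep \<rho> (f A)) \<and>
           (\<forall>g\<in>hom G' SpinC_group.
              (\<forall>A\<in>carrier G'. p' A = Ad (g A) \<and> \<epsilon>' A = spinc_rep \<rho> (g A)) \<longrightarrow>
              (\<forall>A\<in>carrier G'. g A = f A)) \<and>
           (smooth_into_vector_space M p' \<and> smooth_into_vector_space M \<epsilon>' \<longrightarrow>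
              smooth_into_vector_space M (\<lambda>A. spinc_incl (f A)))))"
proof (intro conjI allI impI ballI)
  have rep: "complex_algebra_rep \<rho>"
    using assms(2) by (simp add: irreducible_rep_def)
  show "Ad \<in> hom (SpinC_group :: ('n clifford \<times> complex) set monoid) SO_group"
    by (rule Ad_hom)
  show "spinc_rep \<rho> \<in> hom SpinC_group GL_group"
    by (rule spinc_rep_hom[OF rep])
  show "\<rho> (cclifford_map (Ad A) y) = spinc_rep \<rho> A ** \<rho> y ** matrix_inv (spinc_rep \<rho> A)"
    if "A \<in> carrier SpinC_group" for A y
    by (rule rep_Ad[OF rep that])
  fix G' :: "'g monoid" and M p' \<epsilon>'
  assume *: "lie_group G' M \<and> p' \<in> hom G' SO_group \<and> \<epsilon>' \<in> hom G' GL_group \<and>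
    (\<forall>A\<in>carrier G'. \<forall>y. \<rho> (cclifford_map (p' A) y) = \<epsilon>' A ** \<rho> y ** matrix_inv (\<epsilon>' A))"
  then have lie: "smooth_manifold M" "topspace (man_top M) = carrier G'" "group G'"
    by (simp_all add: lie_group_def)
  have hom: "p' \<in> hom G' SO_group" "\<epsilon>' \<in> hom G' GL_group"
    using * by simp_all
  have "\<exists>X\<in>carrier SpinC_group. Ad X = p' A \<and> spinc_rep \<rho> X = \<epsilon>' A" if A: "A \<in> carrier G'" for A
  proof (rule SpinC_lift[OF assms(2)])
    show "rotation_matrix (p' A)"
      using hom_in_carrier[OF hom(1) A] by (simp add: SO_group_def)
    show "invertible (\<epsilon>' A)"
      using hom_in_carrier[OF hom(2) A] by (simp add: GL_group_def)
    show "\<rho> (cclifford_map (p' A) y) = \<epsilon>' A ** \<rho> y ** matrix_inv (\<epsilon>' A)" for y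
      using * A by blast
  qed blast
  then have "\<forall>A\<in>carrier G'. \<exists>X. X \<in> carrier SpinC_group \<and> Ad X = p' A \<and> spinc_rep \<rho> X = \<epsilon>' A"
    by blast
  then obtain f where "\<forall>A\<in>carrier G'. f A \<in> carrier SpinC_group \<and> Ad (f A) = p' A \<and> spinc_rep \<rho> (f A) = \<epsilon>' A"
    by (rule bchoice[THEN exE])
  then have f: "f A \<in> carrier SpinC_group" "Ad (f A) = p' A" "spinc_rep \<rho> (f A) = \<epsilon>' A"
    if "A \<in> carrier G'" for A
    using that by blast+
  have inj: "X = Y" if "X \<in> carrier SpinC_group" "Y \<in> carrier SpinC_group" "spinc_rep \<rho> X = spinc_rep \<rho> Y" for X Y
    using spinc_rep_injective[OF rep] that by (simp add: inj_on_def)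
  have hom_f: "f \<in> hom G' SpinC_group"
  proof (rule homI)
    fix A B
    assume A: "A \<in> carrier G'" "B \<in> carrier G'"
    interpret group G' by (rule lie(3))
    show "f (A \<otimes>\<^bsub>G'\<^esub> B) = f A \<otimes>\<^bsub>SpinC_group\<^esub> f B"
    proof (rule inj)
      show "f (A \<otimes>\<^bsub>G'\<^esub> B) \<in> carrier SpinC_group" "f A \<otimes>\<^bsub>SpinC_group\<^esub> f B \<in> carrier SpinC_group"
        using A f by (simp_all add: SpinC_mult_closed)
      show "spinc_rep \<rho> (f (A \<otimes>\<^bsub>G'\<^esub> B)) = spinc_rep \<rho> (f A \<otimes>\<^bsub>SpinC_group\<^esub> f B)"
        by (simp add: A f hom_mult[OF hom(2) A] hom_mult[OF spinc_rep_hom[OF rep]] GL_group_def)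
    qed
  qed (use f in blast)
  have unique: "g A = f A"
    if "g \<in> hom G' SpinC_group" "\<forall>A\<in>carrier G'. p' A = Ad (g A) \<and> \<epsilon>' A = spinc_rep \<rho> (g A)"
      "A \<in> carrier G'" for g A
  proof (rule inj)
    show "g A \<in> carrier SpinC_group" "f A \<in> carrier SpinC_group"
      using that(3) f(1) hom_in_carrier[OF that(1,3)] by blast+
    show "spinc_rep \<rho> (g A) = spinc_rep \<rho> (f A)"
      using that(2,3) f(3) by metis
  qed
  have smooth_f: "smooth_into_vector_space M (\<lambda>A. spinc_incl (f A))" if "smooth_into_vector_space M \<epsilon>'"
    by (rule smooth_spinc_incl[OF rep lie(1) _ _ that]) (use f lie(2) in auto)
  show "\<exists>f\<in>hom G' SpinC_group.
     (\<forall>A\<in>carrier G'. p' A = Ad (f A) \<and> \<epsilon>' A = spinc_rep \<rho> (f A)) \<and>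
     (\<forall>g\<in>hom G' SpinC_group.
        (\<forall>A\<in>carrier G'. p' A = Ad (g A) \<and> \<epsilon>' A = spinc_rep \<rho> (g A)) \<longrightarrow>
        (\<forall>A\<in>carrier G'. g A = f A)) \<and>
     (smooth_into_vector_space M p' \<and> smooth_into_vector_space M \<epsilon>' \<longrightarrow>
        smooth_into_vector_space M (\<lambda>A. spinc_incl (f A)))"
  proof (intro bexI[OF _ hom_f] conjI ballI impI)
    show "g A = f A" if "g \<in> hom G' SpinC_group"
      "\<forall>A\<in>carrier G'. p' A = Ad (g A) \<and> \<epsilon>' A = spinc_rep \<rho> (g A)" "A \<in> carrier G'" for g A
      using that by (rule unique)
  qed (use f smooth_f in simp_all)
qed

end
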